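(* Let $n\geq 2$, $m\in\{1,\ldots,n\}$ and $N\geq1$ be integers, let $\mathsf V=\{1,\ldots,n\}$ and $\mathsf E=\{(i,j)\in \mathsf V^2 : i\neq j\}$. Let $H$ be a (not necessarily commutative) ring, $K$ a commutative ring, and $\tau:H\to K$ a central morphism of $\mathbb Z$-modules, that is, an additive map such that $\tau(rr')=\tau(r'r)$ for all $r,r'\in H$. For each $(i,j)\in\mathsf E$ let $h_{ij}\in M_N(H)$. Let $\Delta$ be the $n\times n$ matrix of $N\times N$ blocks $$\Delta_{ij}=-h_{ij}a_{ij}\quad\text{for }(i,j)\in\mathsf E,\qquad \Delta_{ii}=\sum_{j\in\mathsf V\setminus\{i\}}a_{ij}I_N\quad\text{for } i\in\mathsf V,$$ seen as an $Nn\times Nn$ matrix with entries in $H[a_{ij}:(i,j)\in\mathsf E]$, and let $\Delta_{[Nm]}$ be the $Nm\times Nm$ matrix obtained from $\Delta$ by erasing the rows and columns of indices greater than $Nm$. Then in the ring $S=K[a_{ij}:(i,j)\in\mathsf E]$ we have $$\det\nolimits_{\tau}\Delta_{[Nm]}=\sum_{F\in\mathcal{HF}_{m,N}}a_F\prod_{c\in\mathcal H(F)}\bigl(1-\tau(\hat h_c)\bigr)\prod_{c\in\mathcal S(F)}\bigl(-\tau(\hat h_c)\bigr).$$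
   Context: Polynomial rings: $R=H[a_{ij}:(i,j)\in\mathsf E]$ is the polynomial ring over $H$ in $n(n-1)$ indeterminates which commute with each other and with $H$. The map $\tau$ is extended coefficientwise to an additive map $R\to S$, still denoted $\tau$. $\tau$-determinant: for an integer $p\geq1$ and a $p\times p$ matrix $M$ with entries in $R$, $$\det\nolimits_\tau(M)=\sum_{\sigma\in\mathfrak S_p}\varepsilon(\sigma)\prod_{\substack{c\text{ cycle of }\sigma\\ c=(i_1\ldots i_r)}}\tau\bigl(M_{i_1i_2}M_{i_2i_3}\cdots M_{i_ri_1}\bigr)\in S,$$ where $\mathfrak S_p$ is the symmetric group on $p$ elements, $\varepsilon(\sigma)$ is the signature, and fixed points count as cycles of length $1$ (this is well defined because $\tau$ is central). Indexing: the $(N(i-1)+k)$-th row (or column) of $\Delta$ corresponds to the pair $(i,k)$, $i\in\mathsf V$, $k\in\{1,\ldots,N\}$. The graph $\hat{\mathsf G}$: its vertex set is $\mathsf V\times\{1,\ldots,N\}$ and its (directed) edges are all pairs $((i,k),(j,l))$ with $(i,j)\in\mathsf E$ and $(k,l)\in\{1,\ldots,N\}^2$ (so there is no edge with $i=j$). To the edge $((i,k),(j,l))$, going from $(i,k)$ to $(j,l)$, are associated the indeterminate $a_{ij}$ and the element $\hat h_{((i,k),(j,l))}=(h_{ij})_{kl}\in H$, the $(k,l)$ entry of $h_{ij}$. The well of $\hat{\mathsf G}$ is $\{m+1,\ldots,n\}\times\{1,\ldots,N\}$. Forests: $\mathcal F_{m,N}$ is the set of cycle-and-well-rooted spanning forests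 of $\hat{\mathsf G}$, i.e. sets $F$ of edges of $\hat{\mathsf G}$ containing exactly $Nm$ edges, one coming out of each vertex of $\{1,\ldots,m\}\times\{1,\ldots,N\}$. For such $F$, $a_F=\prod_{((i,k),(j,l))\in F}a_{ij}$. Each connected component of $F$ is either a tree rooted at a vertex of the well with edges pointing towards the root, or contains exactly one directed cycle and no vertex of the well; the cycles of $F$ are these directed cycles. An edge $((i,k),(j,l))$ is horizontal if $k=l$. An element $F\in\mathcal F_{m,N}$ is horizontal if every edge of $F$ that is not in a cycle of $F$ is horizontal; $\mathcal{HF}_{m,N}$ is the set of horizontal elements of $\mathcal F_{m,N}$. A cycle of $F$ is horizontal if it consists only of horizontal edges, and skew otherwise; $\mathcal H(F)$ and $\mathcal S(F)$ are respectively the sets of horizontal and of skew cycles of $F$. For a cycle $c$ of $F$, $\hat h_c\in H$ is the product, in cyclic order along $c$, of the elements $\hat h_e$ over the edges $e$ of $c$; it depends on the starting point, but $\tau(\hat h_c)$ does not.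
   Formalization: The formal theorem additionally assumes τ(1)=1 (and H, K nonzero unital rings); without it the claim fails, e.g. n=2, m=N=1, H=K=ℤ, τ(x)=2x gives 2a₁₂ on the left and a₁₂ on the right. *)

theory Defs
  imports
    "HOL-Library.Poly_Mapping"
    "Jordan_Normal_Form.Matrix"
    "HOL-Combinatorics.Permutations"
    "Graph_Theory.Pair_Digraph"
begin

text \<open>
  Vertices, colours and matrix indices all start at \<open>0\<close>, as the library matrices do: the vertices
  are \<open>0, \<dots>, n - 1\<close>, those of the well are \<open>m, \<dots>, n - 1\<close>, the colours are \<open>0, \<dots>, N - 1\<close>, and
  the pair \<open>(i, k)\<close> corresponds to the row (or column) of index \<open>N * i + k\<close>.
\<close>

text \<open>
  \<open>'h mpoly\<close> is the ring of polynomials over \<open>'h\<close> in indeterminates that commute with each other and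
  with \<open>'h\<close>. The type has one indeterminate for each pair of natural numbers; only those of
  \<open>edges n\<close> are used below, and the polynomials in these form a subring.
\<close>

type_synonym 'h mpoly = "((nat \<times> nat) \<Rightarrow>\<^sub>0 nat) \<Rightarrow>\<^sub>0 'h"

definition Const :: "'h::zero \<Rightarrow> 'h mpoly" where
  "Const x = Poly_Mapping.single 0 x"

definition indet :: "nat \<Rightarrow> nat \<Rightarrow> 'h::{zero,one} mpoly" where
  "indet i j = Poly_Mapping.single (Poly_Mapping.single (i, j) 1) 1"

definition edges :: "nat \<Rightarrow> (nat \<times> nat) set" where
  "edges n = {(i, j). i < n \<and> j < n \<and> i \<noteq> j}"

text \<open>
  A directed cycle is represented by its set of arcs, so that it has no distinguished starting point;
  loops are cycles of length \<open>1\<close>. The list of arcs of a cycle, in the order in which they are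
  travelled, is determined up to rotation, so \<open>cycle_prod\<close> depends on the list that is chosen, but
  its image under a central map does not.
\<close>

definition cycles :: "'v pair_pre_digraph \<Rightarrow> ('v \<times> 'v) set set" where
  "cycles G = {set p | p. pre_digraph.cycle (with_proj G) p}"

definition cycle_prod ::
  "'v pair_pre_digraph \<Rightarrow> ('v \<times> 'v \<Rightarrow> 'r::monoid_mult) \<Rightarrow> ('v \<times> 'v) set \<Rightarrow> 'r" where
  "cycle_prod G w c =
     prod_list (map w (SOME p. pre_digraph.cycle (with_proj G) p \<and> set p = c))"

text \<open>
  The cycles of a permutation, fixed points included, are the directed cycles of the digraph with
  an arc from \<open>i\<close> to \<open>\<sigma> i\<close> for each \<open>i\<close>. \<open>Poly_Mapping.map \<tau>\<close> applies \<open>\<tau>\<close> to each coefficient.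
\<close>

definition perm_digraph :: "nat \<Rightarrow> (nat \<Rightarrow> nat) \<Rightarrow> nat pair_pre_digraph" where
  "perm_digraph p \<sigma> = \<lparr>pverts = {..<p}, parcs = {(i, \<sigma> i) | i. i < p}\<rparr>"

definition det_tau ::
  "('h::ring_1 \<Rightarrow> 'k::comm_ring_1) \<Rightarrow> 'h mpoly mat \<Rightarrow> 'k mpoly" where
  "det_tau \<tau> M =
     (\<Sum>\<sigma> | \<sigma> permutes {..<dim_row M}.
        of_int (sign \<sigma>) *
        (\<Prod>c\<in>cycles (perm_digraph (dim_row M) \<sigma>).
           Poly_Mapping.map \<tau> (cycle_prod (perm_digraph (dim_row M) \<sigma>) (\<lambda>e. M $$ e) c)))"

definition Delta_block ::
  "nat \<Rightarrow> nat \<Rightarrow> (nat \<Rightarrow> nat \<Rightarrow> 'h::ring_1 mat) \<Rightarrow> nat \<Rightarrow> nat \<Rightarrow> 'h mpoly mat" where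
  "Delta_block n N h i j =
     (if i = j then (\<Sum>l\<in>{..<n} - {i}. indet i l) \<cdot>\<^sub>m 1\<^sub>m N
      else - map_mat (\<lambda>x. Const x * indet i j) (h i j))"

definition Delta ::
  "nat \<Rightarrow> nat \<Rightarrow> (nat \<Rightarrow> nat \<Rightarrow> 'h::ring_1 mat) \<Rightarrow> 'h mpoly mat" where
  "Delta n N h =
     mat (N * n) (N * n) (\<lambda>(r, s). Delta_block n N h (r div N) (s div N) $$ (r mod N, s mod N))"

definition leading_submatrix :: "nat \<Rightarrow> 'a mat \<Rightarrow> 'a mat" where
  "leading_submatrix p A = mat p p (\<lambda>(r, s). A $$ (r, s))"

type_synonym vertex = "nat \<times> nat"
type_synonym edge = "vertex \<times> vertex"

definition hat_edges :: "nat \<Rightarrow> nat \<Rightarrow> edge set" where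
  "hat_edges n N = {((i, k), (j, l)). (i, j) \<in> edges n \<and> k < N \<and> l < N}"

definition edge_indet :: "edge \<Rightarrow> 'h::{zero,one} mpoly" where
  "edge_indet = (\<lambda>((i, k), (j, l)). indet i j)"

definition hat_h :: "(nat \<Rightarrow> nat \<Rightarrow> 'h mat) \<Rightarrow> edge \<Rightarrow> 'h" where
  "hat_h h = (\<lambda>((i, k), (j, l)). h i j $$ (k, l))"

text \<open>The cycle-and-well-rooted spanning forests of the graph with arcs \<open>hat_edges n N\<close>.\<close>

definition forests :: "nat \<Rightarrow> nat \<Rightarrow> nat \<Rightarrow> edge set set" where
  "forests n m N =
     {F. F \<subseteq> hat_edges n N \<and> card F = N * m \<and>
         (\<forall>v\<in>{..<m} \<times> {..<N}. \<exists>!e. e \<in> F \<and> fst e = v)}"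

definition forest_digraph :: "nat \<Rightarrow> nat \<Rightarrow> edge set \<Rightarrow> vertex pair_pre_digraph" where
  "forest_digraph n N F = \<lparr>pverts = {..<n} \<times> {..<N}, parcs = F\<rparr>"

definition horizontal_edge :: "edge \<Rightarrow> bool" where
  "horizontal_edge = (\<lambda>((i, k), (j, l)). k = l)"

definition horizontal_forests :: "nat \<Rightarrow> nat \<Rightarrow> nat \<Rightarrow> edge set set" where
  "horizontal_forests n m N =
     {F \<in> forests n m N. \<forall>e \<in> F - \<Union>(cycles (forest_digraph n N F)). horizontal_edge e}"

definition horizontal_cycles :: "nat \<Rightarrow> nat \<Rightarrow> edge set \<Rightarrow> edge set set" where
  "horizontal_cycles n N F = {c \<in> cycles (forest_digraph n N F). \<forall>e\<in>c. horizontal_edge e}"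

definition skew_cycles :: "nat \<Rightarrow> nat \<Rightarrow> edge set \<Rightarrow> edge set set" where
  "skew_cycles n N F = cycles (forest_digraph n N F) - horizontal_cycles n N F"

definition forest_holonomy ::
  "nat \<Rightarrow> nat \<Rightarrow> (nat \<Rightarrow> nat \<Rightarrow> 'h::ring_1 mat) \<Rightarrow> edge set \<Rightarrow> edge set \<Rightarrow> 'h" where
  "forest_holonomy n N h F c = cycle_prod (forest_digraph n N F) (hat_h h) c"

text \<open>
  The identity between the \<open>\<tau>\<close>-determinant of the leading submatrix of \<open>Delta\<close> and the sum over
  horizontal forests requires the normalisation \<open>\<tau> 1 = 1\<close>: for \<open>n = 2\<close> and \<open>m = N = 1\<close> the former is
  \<open>\<tau> 1\<close> times the indeterminate \<open>indet 0 1\<close> and the latter is \<open>indet 0 1\<close>.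
\<close>

end

theory Submission
  imports Defs "HOL-Combinatorics.Cycles"
begin

text \<open>
  Write \<open>U\<close> for the set of the \<open>N * m\<close> indices of the submatrix. The \<open>\<tau>\<close>-determinant is a sum over
  permutations \<open>\<sigma>\<close> of \<open>U\<close>, and every term factors over the cycles of \<open>\<sigma>\<close>. The signature and the signs of
  the off-diagonal entries cancel up to one minus sign per cycle, so a cycle \<open>c\<close> of length at least two
  contributes \<open>- \<tau> (h\<^sub>c)\<close> times its indeterminates, where \<open>h\<^sub>c\<close> is the product of the coefficients along
  \<open>c\<close> (or \<open>0\<close>, if \<open>c\<close> has an arc inside a block), and a fixed point \<open>(i, k)\<close> contributes the sum of the
  \<open>a\<^sub>i\<^sub>l\<close>, one indeterminate for each horizontal arc out of \<open>(i, k)\<close> (\<open>det_tau_term\<close>).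

  Expanding the sums at the fixed points turns a term into a sum over functions \<open>f\<close> on \<open>U\<close>, each of
  which follows \<open>\<sigma>\<close> at the moved points and chooses a horizontal arc at the fixed ones. The graph of \<open>f\<close> is
  a forest \<open>F\<close>, and the cycles of \<open>\<sigma>\<close> of length at least two are some of the cycles of \<open>F\<close>.
  Conversely, for a given forest \<open>F\<close>, the permutations that lead to it correspond to the sets \<open>A\<close> of
  cycles of \<open>F\<close> such that all arcs of \<open>F\<close> outside the cycles in \<open>A\<close> are horizontal. Such an \<open>A\<close> exists only if \<open>F\<close> is a horizontal forest; it then
  contains all skew cycles and an arbitrary set of horizontal ones. Summing the product of the
  \<open>- \<tau> (h\<^sub>c)\<close> over these \<open>A\<close> gives a factor \<open>- \<tau> (h\<^sub>c)\<close> for each skew cycle and a factor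
  \<open>1 - \<tau> (h\<^sub>c)\<close> for each horizontal cycle (\<open>sum_circuit_subsets\<close>, \<open>sum_permutations_eq_sum_functions\<close>).

  This argument is carried out for functions on the indices, with circuits as sets of arcs, and forests
  are identified with such functions at the end (\<open>horizontal_forests_eq\<close>). A product along a cycle depends
  on its starting point, but two listings of one cycle differ by a rotation only
  (\<open>arc_circuit_unique_up_to_rotation\<close>), so that its image under a central map does not
  (\<open>central_circuit_prod\<close>).
\<close>

section \<open>Directed circuits as sets of arcs\<close>

text \<open>
  The last condition says that each arc ends where the next one begins, cyclically. Since the tails
  are distinct, the circuit is simple, and loops are allowed.
\<close>

definition arc_circuit :: "('v \<times> 'v) list \<Rightarrow> bool" where
  "arc_circuit p \<longleftrightarrow> p \<noteq> [] \<and> distinct (map fst p) \<and> map snd p = rotate1 (map fst p)"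

definition circuits :: "('v \<times> 'v) set \<Rightarrow> ('v \<times> 'v) set set" where
  "circuits E = {set p | p. arc_circuit p \<and> set p \<subseteq> E}"

text \<open>
  The choice is made from the set of arcs alone, with no reference to an ambient digraph, so that the
  products along one and the same circuit in two different digraphs agree literally.
\<close>

definition circuit_prod :: "('v \<times> 'v \<Rightarrow> 'r::monoid_mult) \<Rightarrow> ('v \<times> 'v) set \<Rightarrow> 'r" where
  "circuit_prod w c = prod_list (map w (SOME p. arc_circuit p \<and> set p = c))"

lemma pcas_iff_tails_heads: "pcas u p v \<longleftrightarrow> map fst p @ [v] = u # map snd p"
  by (induction p arbitrary: u)
    (simp_all only: list.map append.simps pcas.simps list.inject, blast+)

lemma pawalk_verts_of_pcas: "pcas u p v \<Longrightarrow> pawalk_verts u p = u # map snd p"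
  by (induction p arbitrary: u)
    (simp_all only: list.map append.simps pcas.simps list.inject pawalk_verts.simps)

text \<open>
  An arc walk with arcs \<open>p\<close> from \<open>u\<close> back to \<open>u\<close> visits \<open>u\<close> and then the heads of \<open>p\<close>; comparing
  this with the tails of \<open>p\<close> followed by \<open>u\<close> shows that closing up amounts to the heads being the
  tails rotated by one.
\<close>

lemma cycle_iff_arc_circuit:
  assumes "fst ` parcs G \<subseteq> pverts G"
  shows "pre_digraph.cycle (with_proj G) p \<longleftrightarrow> arc_circuit p \<and> set p \<subseteq> parcs G"
proof (cases p)
  case Nil
  then show ?thesis by (simp add: pre_digraph.cycle_def arc_circuit_def)
next
  case (Cons e es)
  have "pcas u p u \<Longrightarrow> tl (pawalk_verts u p) = map snd p" for u
    by (simp add: pawalk_verts_of_pcas)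
  moreover have "p \<noteq> []" using Cons by simp
  ultimately have "pre_digraph.cycle (with_proj G) p \<longleftrightarrow>
      (\<exists>u. u \<in> pverts G \<and> set p \<subseteq> parcs G \<and> pcas u p u \<and> distinct (map snd p))"
    by (auto simp: pre_digraph.cycle_def pre_digraph.awalk_def cas_with_proj_eq
      awalk_verts_with_proj_eq cong: conj_cong)
  also have "\<dots> \<longleftrightarrow> set p \<subseteq> parcs G \<and> pcas (fst e) p (fst e) \<and> distinct (map snd p)"
    using Cons assms by (auto simp del: pawalk_verts.simps)
  also have "pcas (fst e) p (fst e) \<longleftrightarrow> map snd p = rotate1 (map fst p)"
    unfolding pcas_iff_tails_heads using Cons by auto
  finally show ?thesis
    using \<open>p \<noteq> []\<close> by (auto simp: arc_circuit_def)
qed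

lemma cycles_eq_circuits:
  assumes "fst ` parcs G \<subseteq> pverts G"
  shows "cycles G = circuits (parcs G)"
  by (auto simp: cycles_def circuits_def cycle_iff_arc_circuit[OF assms])

lemma cycle_prod_eq_circuit_prod:
  assumes "fst ` parcs G \<subseteq> pverts G" "c \<in> circuits (parcs G)"
  shows "cycle_prod G w c = circuit_prod w c"
proof -
  have "c \<subseteq> parcs G" using assms(2) by (auto simp: circuits_def)
  then have "(\<lambda>p. pre_digraph.cycle (with_proj G) p \<and> set p = c) = (\<lambda>p. arc_circuit p \<and> set p = c)"
    by (auto simp: cycle_iff_arc_circuit[OF assms(1)])
  then show ?thesis by (simp add: cycle_prod_def circuit_prod_def)
qed

lemma arc_circuit_distinct: "arc_circuit p \<Longrightarrow> distinct p"
  by (auto simp: arc_circuit_def distinct_map)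

lemma arc_circuit_inj_fst: "arc_circuit p \<Longrightarrow> inj_on fst (set p)"
  by (auto simp: arc_circuit_def distinct_map)

lemma arc_circuit_nth:
  assumes "arc_circuit p" "i < length p"
  shows "snd (p ! i) = fst (p ! (Suc i mod length p))"
proof -
  have "map snd p ! i = rotate1 (map fst p) ! i"
    using assms by (simp add: arc_circuit_def)
  then show ?thesis using assms by (auto simp: nth_rotate1 arc_circuit_def)
qed

text \<open>
  In a circuit an arc is determined by its tail, hence the successor of an arc is determined by the
  set of arcs; two listings of this set can only differ by their starting point.
\<close>

lemma arc_circuit_unique_up_to_rotation:
  assumes p: "arc_circuit p" and q: "arc_circuit q" and pq: "set p = set q"
  shows "\<exists>k. q = rotate k p"
proof -
  let ?n = "length p"
  have len: "length q = ?n"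
    using p q pq by (metis arc_circuit_distinct distinct_card)
  have n: "0 < ?n" using p by (simp add: arc_circuit_def)
  obtain k where k: "k < ?n" "p ! k = q ! 0"
    using n len pq by (metis in_set_conv_nth)
  have "i < ?n \<Longrightarrow> q ! i = p ! ((k + i) mod ?n)" for i
  proof (induction i)
    case 0
    then show ?case using k by simp
  next
    case (Suc i)
    have "fst (q ! Suc i) = snd (q ! i)"
      using arc_circuit_nth[OF q, of i] Suc.prems len by simp
    also have "\<dots> = snd (p ! ((k + i) mod ?n))"
      using Suc by simp
    also have "\<dots> = fst (p ! ((k + Suc i) mod ?n))"
      using arc_circuit_nth[OF p, of "(k + i) mod ?n"] n by (simp add: mod_Suc_eq)
    finally show ?case
      using arc_circuit_inj_fst[OF p] Suc.prems len n pq
      by (metis inj_onD mod_less_divisor nth_mem)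
  qed
  then have "q = rotate k p"
    by (intro nth_equalityI) (auto simp: len nth_rotate add.commute)
  then show ?thesis ..
qed

lemma central_prod_list_rotate:
  fixes \<tau> :: "'r::monoid_mult \<Rightarrow> 's"
  assumes "\<And>x y. \<tau> (x * y) = \<tau> (y * x)"
  shows "\<tau> (prod_list (map w (rotate k p))) = \<tau> (prod_list (map w p))"
proof -
  have "rotate k p = drop (k mod length p) p @ take (k mod length p) p"
    by (rule rotate_drop_take)
  then have "\<tau> (prod_list (map w (rotate k p))) =
      \<tau> (prod_list (map w (take (k mod length p) p)) * prod_list (map w (drop (k mod length p) p)))"
    using assms by simp
  also have "\<dots> = \<tau> (prod_list (map w (take (k mod length p) p @ drop (k mod length p) p)))"
    by (simp only: map_append prod_list.append)
  finally show ?thesis by simp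
qed

lemma central_circuit_prod:
  fixes \<tau> :: "'r::monoid_mult \<Rightarrow> 's"
  assumes "\<And>x y. \<tau> (x * y) = \<tau> (y * x)" and p: "arc_circuit p"
  shows "\<tau> (circuit_prod w (set p)) = \<tau> (prod_list (map w p))"
proof -
  let ?q = "SOME q. arc_circuit q \<and> set q = set p"
  have "arc_circuit ?q \<and> set ?q = set p"
    by (rule someI[of _ p]) (use p in simp)
  then obtain k where "?q = rotate k p"
    using arc_circuit_unique_up_to_rotation[OF p, of ?q] by metis
  then show ?thesis
    using central_prod_list_rotate[of \<tau> w k p] assms(1) by (simp add: circuit_prod_def)
qed

lemma circuits_subset: "c \<in> circuits E \<Longrightarrow> c \<subseteq> E"
  by (auto simp: circuits_def)

lemma circuits_mono: "E \<subseteq> E' \<Longrightarrow> circuits E \<subseteq> circuits E'"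
  by (auto simp: circuits_def)

lemma circuits_restrict: "c \<in> circuits E \<Longrightarrow> c \<subseteq> E' \<Longrightarrow> c \<in> circuits E'"
  by (auto simp: circuits_def)

lemma circuits_finite: "c \<in> circuits E \<Longrightarrow> finite c"
  by (auto simp: circuits_def)

lemma circuits_nonempty: "c \<in> circuits E \<Longrightarrow> c \<noteq> {}"
  by (auto simp: circuits_def arc_circuit_def)

lemma finite_circuits: "finite E \<Longrightarrow> finite (circuits E)"
  by (rule finite_subset[of _ "Pow E"]) (auto simp: circuits_def)

lemma circuit_heads_eq_tails: "c \<in> circuits E \<Longrightarrow> snd ` c = fst ` c"
  unfolding circuits_def arc_circuit_def by (smt (verit) mem_Collect_eq set_map set_rotate1)

text \<open>
  When at most one arc of \<open>E\<close> leaves each vertex, the walk along \<open>p\<close> from a common arc is forced to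
  stay in \<open>X\<close>.
\<close>

lemma circuit_subset_of_successor_closed:
  assumes p: "arc_circuit p" and inj: "inj_on fst E" and "set p \<subseteq> E" "X \<subseteq> E"
    and closed: "snd ` X \<subseteq> fst ` X" and e: "e \<in> set p" "e \<in> X"
  shows "set p \<subseteq> X"
proof -
  let ?n = "length p"
  obtain k where k: "k < ?n" "p ! k = e" using e by (metis in_set_conv_nth)
  have n: "0 < ?n" using k by (cases p) auto
  have walk: "p ! ((k + i) mod ?n) \<in> X" for i
  proof (induction i)
    case 0
    then show ?case using k e by simp
  next
    case (Suc i)
    have "fst (p ! ((k + Suc i) mod ?n)) = snd (p ! ((k + i) mod ?n))"
      using arc_circuit_nth[OF p, of "(k + i) mod ?n"] n by (simp add: mod_Suc_eq)
    then have "fst (p ! ((k + Suc i) mod ?n)) \<in> fst ` X"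
      using Suc closed by auto
    moreover have "p ! ((k + Suc i) mod ?n) \<in> E"
      using assms(3) n by (metis mod_less_divisor nth_mem subsetD)
    ultimately show ?case using inj_on_image_mem_iff[OF inj _ assms(4)] by blast
  qed
  show ?thesis
  proof
    fix a assume "a \<in> set p"
    then obtain j where j: "j < ?n" "p ! j = a" by (metis in_set_conv_nth)
    \<comment> \<open>Adding \<open>?n\<close> keeps the natural subtraction from truncating when \<open>j < k\<close>.\<close>
    have "(k + (?n + j - k)) mod ?n = j" using j k by simp
    then show "a \<in> X" using walk[of "?n + j - k"] j by simp
  qed
qed

text \<open>
  Two circuits with a common arc contain each other by the previous lemma, as each is closed under
  successors. The circuits of a functional digraph are thus pairwise disjoint.
\<close>

lemma circuits_eqI:
  assumes "inj_on fst E" "c \<in> circuits E" "c' \<in> circuits E" "e \<in> c" "e \<in> c'"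
  shows "c = c'"
proof -
  have "d \<subseteq> d'" if "d \<in> circuits E" "d' \<in> circuits E" "e \<in> d" "e \<in> d'" for d d'
  proof -
    obtain p where p: "arc_circuit p" "set p \<subseteq> E" "d = set p"
      using \<open>d \<in> circuits E\<close> by (auto simp: circuits_def)
    have "set p \<subseteq> d'"
      by (rule circuit_subset_of_successor_closed[OF p(1) assms(1) p(2)])
         (use that p circuits_subset[OF that(2)] circuit_heads_eq_tails[OF that(2)] in auto)
    then show ?thesis using p by simp
  qed
  then show ?thesis using assms by blast
qed

lemma singleton_loop_circuit: "(v, v) \<in> E \<Longrightarrow> {(v, v)} \<in> circuits E"
  unfolding circuits_def arc_circuit_def by (rule CollectI, rule exI[of _ "[(v, v)]"]) simp

text \<open>
  A circuit that contains a loop consists of this loop alone, by disjointness. Hence \<open>circuits (E - Id)\<close>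
  are exactly the circuits of length at least two.
\<close>

lemma circuits_split_loops:
  assumes "inj_on fst E"
  shows "circuits E = circuits (E - Id) \<union> (\<lambda>e. {e}) ` (E \<inter> Id)"
proof -
  have "c \<in> circuits (E - Id)" if "c \<in> circuits E" "c \<notin> (\<lambda>e. {e}) ` (E \<inter> Id)" for c
  proof (rule circuits_restrict[OF that(1)])
    have "e \<notin> Id" if "e \<in> c" for e
      using circuits_eqI[OF assms \<open>c \<in> circuits E\<close> singleton_loop_circuit \<open>e \<in> c\<close>]
        circuits_subset[OF \<open>c \<in> circuits E\<close>] \<open>e \<in> c\<close> \<open>c \<notin> (\<lambda>e. {e}) ` (E \<inter> Id)\<close>
      by (cases e) auto
    then show "c \<subseteq> E - Id" using circuits_subset[OF \<open>c \<in> circuits E\<close>] by auto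
  qed
  then show ?thesis
    using circuits_mono[of "E - Id" E] singleton_loop_circuit by auto
qed

lemma arc_circuit_map_inj:
  assumes "inj \<phi>"
  shows "arc_circuit (map (map_prod \<phi> \<phi>) p) \<longleftrightarrow> arc_circuit p"
proof -
  have "map fst (map (map_prod \<phi> \<phi>) p) = map \<phi> (map fst p)"
       "map snd (map (map_prod \<phi> \<phi>) p) = map \<phi> (map snd p)" by simp_all
  then show ?thesis
    using assms unfolding arc_circuit_def
    by (metis (no_types, lifting) Nil_is_map_conv distinct_map inj_map_eq_map inj_on_subset
        rotate1_map subset_UNIV)
qed

lemma circuits_image_inj:
  assumes "inj \<phi>"
  shows "circuits (map_prod \<phi> \<phi> ` E) = (`) (map_prod \<phi> \<phi>) ` circuits E"
proof -
  let ?F = "map_prod \<phi> \<phi>"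
  have inj: "inj ?F" using assms by (simp add: prod.inj_map)
  show ?thesis
  proof (intro equalityI subsetI)
    fix c assume "c \<in> circuits (?F ` E)"
    then obtain p where p: "arc_circuit p" "set p \<subseteq> ?F ` E" "c = set p"
      by (auto simp: circuits_def)
    obtain D where D: "D \<subseteq> E" "set p = ?F ` D"
      using p(2) by (metis subset_imageE)
    define q where "q = map (inv_into UNIV ?F) p"
    have "map ?F q = p"
      unfolding q_def map_map
      by (rule map_idI) (metis D(2) comp_apply f_inv_into_f image_mono subset_UNIV subsetD)
    moreover have "set q = D"
      unfolding q_def using D inj by (simp add: image_comp)
    ultimately show "c \<in> (`) ?F ` circuits E"
      using p D arc_circuit_map_inj[OF assms, of q] by (auto simp: circuits_def)
  next
    fix c assume "c \<in> (`) ?F ` circuits E"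
    then obtain p where "arc_circuit p" "set p \<subseteq> E" "c = set (map ?F p)"
      by (auto simp: circuits_def)
    then show "c \<in> circuits (?F ` E)"
      using arc_circuit_map_inj[OF assms, of p] unfolding circuits_def by fastforce
  qed
qed

section \<open>Circuits of functions and permutations\<close>

definition graph_of :: "'v set \<Rightarrow> ('v \<Rightarrow> 'v) \<Rightarrow> ('v \<times> 'v) set" where
  "graph_of U f = (\<lambda>v. (v, f v)) ` U"

lemma graph_of_inj_fst: "inj_on fst (graph_of U f)"
  by (auto simp: graph_of_def inj_on_def)

lemma mem_graph_of [simp]: "(v, w) \<in> graph_of U f \<longleftrightarrow> v \<in> U \<and> w = f v"
  by (auto simp: graph_of_def)

lemma finite_graph_of: "finite U \<Longrightarrow> finite (graph_of U f)"
  by (simp add: graph_of_def)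

text \<open>
  Following the powers of \<open>\<sigma>\<close> from a moved point gives a circuit through it.
\<close>

lemma permutation_circuits_cover:
  assumes "finite U" "\<sigma> permutes U"
  shows "\<Union> (circuits (graph_of U \<sigma> - Id)) = graph_of U \<sigma> - Id"
proof
  show "\<Union> (circuits (graph_of U \<sigma> - Id)) \<subseteq> graph_of U \<sigma> - Id"
    using circuits_subset by blast
next
  have perm: "permutation \<sigma>" using assms permutes_imp_permutation by blast
  show "graph_of U \<sigma> - Id \<subseteq> \<Union> (circuits (graph_of U \<sigma> - Id))"
  proof
    fix e assume e: "e \<in> graph_of U \<sigma> - Id"
    define v where "v = fst e"
    have ev: "e = (v, \<sigma> v)" "v \<in> U" "\<sigma> v \<noteq> v"
      using e by (cases e; auto simp: v_def)+
    let ?r = "least_power \<sigma> v"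
    define p where "p = map (\<lambda>i. ((\<sigma> ^^ i) v, (\<sigma> ^^ Suc i) v)) [0..<?r]"
    have r: "?r > 0" "(\<sigma> ^^ ?r) v = v" using least_power_of_permutation[OF perm] by auto
    have tails: "map fst p = support \<sigma> v" by (simp add: p_def comp_def)
    have "map snd p ! i = rotate1 (map fst p) ! i" if "i < ?r" for i
    proof (cases "Suc i = ?r")
      case True
      then show ?thesis using that r by (simp add: p_def nth_rotate1 flip: funpow.simps)
    next
      case False
      then show ?thesis using that by (simp add: p_def nth_rotate1)
    qed
    then have "map snd p = rotate1 (map fst p)"
      by (intro nth_equalityI) (auto simp: p_def)
    then have circ: "arc_circuit p"
      using cycle_of_permutation[OF perm, of v] r(1)
      unfolding arc_circuit_def tails by (auto simp: p_def)
    have "(\<sigma> ^^ i) v \<in> U" for i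
      using permutes_in_image[OF permutes_funpow[OF assms(2)]] ev by blast
    moreover have "(\<sigma> ^^ i) v \<noteq> \<sigma> ((\<sigma> ^^ i) v)" for i
      using ev(3) permutes_inj[OF permutes_funpow[OF assms(2), of i]]
      by (metis funpow_swap1 injD)
    ultimately have "set p \<subseteq> graph_of U \<sigma> - Id" by (auto simp: p_def graph_of_def)
    then have "set p \<in> circuits (graph_of U \<sigma> - Id)" using circ by (auto simp: circuits_def)
    moreover have "e \<in> set p"
      using r(1) ev unfolding p_def by (auto intro!: image_eqI[of _ _ 0])
    ultimately show "e \<in> \<Union> (circuits (graph_of U \<sigma> - Id))" by blast
  qed
qed

text \<open>
  The candidate for the permutation that turns the points on the circuits in \<open>A\<close> and fixes all other
  points; it is used for sets \<open>A\<close> of circuits of the graph of \<open>f\<close>.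
\<close>

definition move_along :: "('v \<Rightarrow> 'v) \<Rightarrow> ('v \<times> 'v) set set \<Rightarrow> 'v \<Rightarrow> 'v" where
  "move_along f A v = (if v \<in> fst ` \<Union>A then f v else v)"

text \<open>
  It suffices that \<open>move_along f A\<close> maps \<open>U\<close> onto itself, which holds because the heads of a circuit
  are its tails.
\<close>

lemma move_along_permutes:
  assumes "finite U" and A: "A \<subseteq> circuits (graph_of U f)"
  shows "move_along f A permutes U"
proof -
  have AU: "fst ` \<Union>A \<subseteq> U" and arcs: "\<And>e. e \<in> \<Union>A \<Longrightarrow> snd e = f (fst e)"
    using A circuits_subset by (fastforce simp: graph_of_def)+
  have heads: "snd ` \<Union>A = fst ` \<Union>A"
    unfolding image_Union
    by (rule SUP_cong[OF refl]) (use A circuit_heads_eq_tails in blast)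
  have "move_along f A ` (fst ` \<Union>A) = snd ` \<Union>A"
    unfolding image_image using arcs by (intro image_cong) (auto simp: move_along_def)
  moreover have "move_along f A ` (U - fst ` \<Union>A) = U - fst ` \<Union>A"
    by (auto simp: move_along_def)
  ultimately have "move_along f A ` U = U"
    using AU heads by (metis Un_Diff_cancel image_Un sup.absorb_iff2)
  then have "bij_betw (move_along f A) U U"
    using assms(1) by (simp add: bij_betw_def eq_card_imp_inj_on)
  then show ?thesis
    by (rule bij_imp_permutes) (use AU in \<open>auto simp: move_along_def\<close>)
qed

lemma sign_cycle_of_list:
  assumes "distinct cs" "cs \<noteq> []"
  shows "sign (cycle_of_list cs) = - ((-1) ^ length cs)"
  using assms
proof (induction cs rule: cycle_of_list.induct)
  case (1 i j cs)
  have "sign (cycle_of_list (i # j # cs)) = sign (transpose i j) * sign (cycle_of_list (j # cs))"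
    unfolding cycle_of_list.simps
    by (rule sign_compose) (rule permutation_swap_id permutation_of_cycle)+
  also have "\<dots> = - ((-1) ^ length (i # j # cs))"
    using 1 by (simp add: sign_swap_id)
  finally show ?case .
qed simp_all

text \<open>
  Adding one circuit \<open>c\<close> composes with a cyclic permutation of length \<open>card c\<close>, because the circuits
  have disjoint supports.
\<close>

lemma sign_move_along:
  assumes "finite U" and "A \<subseteq> circuits (graph_of U f)"
  shows "sign (move_along f A) = (\<Prod>c\<in>A. - ((-1) ^ card c))"
proof -
  have "finite A" using assms finite_circuits finite_graph_of finite_subset by metis
  then show ?thesis using assms(2)
  proof (induction A rule: finite_induct)
    case empty
    have "move_along f {} = id" by (auto simp: move_along_def)
    then show ?case by simp
  next
    case (insert c A)
    then obtain p where p: "arc_circuit p" "c = set p" "set p \<subseteq> graph_of U f"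
      by (auto simp: circuits_def)
    let ?cs = "map fst p"
    have heads: "map (cycle_of_list ?cs) ?cs = map snd p"
      using cyclic_rotation[of ?cs 1] p(1) by (simp add: arc_circuit_def)
    have on_c: "cycle_of_list ?cs v = f v" if v: "v \<in> fst ` c" for v
    proof -
      obtain i where i: "i < length p" "v = fst (p ! i)"
        using v p(2) by (metis imageE in_set_conv_nth)
      have "cycle_of_list ?cs v = snd (p ! i)"
        using arg_cong[OF heads, of "\<lambda>xs. xs ! i"] i by simp
      moreover have "p ! i \<in> graph_of U f" using p(3) i by auto
      ultimately show ?thesis using i by (auto simp: graph_of_def)
    qed
    have off_c: "cycle_of_list ?cs v = v" if "v \<notin> fst ` c" for v
      using id_outside_supp[of v ?cs] that p(2) by simp
    \<comment> \<open>A common tail would give a common arc, as both circuits lie in the graph of \<open>f\<close>.\<close>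
    have disj: "fst ` c \<inter> fst ` \<Union>A = {}"
    proof (rule ccontr)
      assume "fst ` c \<inter> fst ` \<Union>A \<noteq> {}"
      then obtain e e' c' where e: "e \<in> c" "e' \<in> c'" "c' \<in> A" "fst e = fst e'" by force
      then have "c' \<in> circuits (graph_of U f)" "c \<in> circuits (graph_of U f)"
        using insert.prems by auto
      moreover have "e = e'"
        using e calculation circuits_subset by (intro inj_onD[OF graph_of_inj_fst, of e e' U f]) blast+
      ultimately have "c = c'" using e circuits_eqI[OF graph_of_inj_fst] by blast
      then show False using e insert.hyps by blast
    qed
    have inA: "f v \<in> fst ` \<Union>A" if v: "v \<in> fst ` \<Union>A" for v
    proof -
      obtain e c' where e: "e \<in> c'" "c' \<in> A" "v = fst e" using v by blast
      then have c': "c' \<in> circuits (graph_of U f)" using insert.prems by auto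
      have "snd e \<in> fst ` c'" using circuit_heads_eq_tails[OF c'] e(1) by blast
      moreover have "e \<in> graph_of U f" using circuits_subset[OF c'] e(1) by blast
      then have "snd e = f v" using e(3) by (auto simp: graph_of_def)
      ultimately show ?thesis using e(2) by auto
    qed
    have "move_along f (insert c A) = cycle_of_list ?cs \<circ> move_along f A"
    proof
      fix v
      consider "v \<in> fst ` c" | "v \<in> fst ` \<Union>A" | "v \<notin> fst ` c" "v \<notin> fst ` \<Union>A" by blast
      then show "move_along f (insert c A) v = (cycle_of_list ?cs \<circ> move_along f A) v"
      proof cases
        case 1
        then have "v \<notin> fst ` \<Union>A" using disj by blast
        then show ?thesis using 1 on_c by (simp add: move_along_def image_Un)
      next
        case 2
        then have "f v \<notin> fst ` c" using disj inA by blast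
        then show ?thesis using 2 off_c by (simp add: move_along_def image_Un)
      next
        case 3
        then show ?thesis using off_c by (simp add: move_along_def image_Un)
      qed
    qed
    moreover have "permutation (move_along f A)"
      using move_along_permutes[OF assms(1)] insert.prems assms(1) permutes_imp_permutation by blast
    ultimately have "sign (move_along f (insert c A)) = sign (cycle_of_list ?cs) * sign (move_along f A)"
      by (simp add: sign_compose permutation_of_cycle)
    also have "sign (cycle_of_list ?cs) = - ((-1) ^ card c)"
      using p(1) arc_circuit_distinct[OF p(1)] p(2)
      by (subst sign_cycle_of_list) (auto simp: arc_circuit_def distinct_card)
    finally show ?case using insert by simp
  qed
qed

text \<open>
  This lemma and the next make \<open>move_along f\<close> a bijection from the sets of circuits of \<open>f\<close> onto the
  permutations that agree with \<open>f\<close> wherever they move a point. The hypothesis that \<open>f\<close> moves every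
  point rules out loops, which would be lost on the side of permutations.
\<close>

lemma proper_circuits_move_along:
  assumes "\<And>v. v \<in> U \<Longrightarrow> f v \<noteq> v" and A: "A \<subseteq> circuits (graph_of U f)"
  shows "circuits (graph_of U (move_along f A) - Id) = A"
proof
  have AU: "\<Union>A \<subseteq> graph_of U f" using A circuits_subset by blast
  show "A \<subseteq> circuits (graph_of U (move_along f A) - Id)"
  proof
    fix c assume c: "c \<in> A"
    then have "c \<subseteq> graph_of U (move_along f A) - Id"
      using AU assms(1) by (force simp: graph_of_def move_along_def)
    then show "c \<in> circuits (graph_of U (move_along f A) - Id)"
      using c A circuits_restrict by blast
  qed
  show "circuits (graph_of U (move_along f A) - Id) \<subseteq> A"
  proof
    fix c assume c: "c \<in> circuits (graph_of U (move_along f A) - Id)"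
    have arcs: "e \<in> graph_of U f \<and> e \<in> \<Union>A" if "e \<in> c" for e
    proof -
      have e: "e \<in> graph_of U (move_along f A)" "e \<notin> Id"
        using circuits_subset[OF c] that by auto
      then have "fst e \<in> fst ` \<Union>A" and ef: "e \<in> graph_of U f"
        by (auto simp: graph_of_def move_along_def split: if_splits)
      then show ?thesis using inj_on_image_mem_iff[OF graph_of_inj_fst ef AU] by blast
    qed
    then have cf: "c \<in> circuits (graph_of U f)"
      using c circuits_restrict by blast
    obtain e where "e \<in> c" using circuits_nonempty[OF c] by blast
    then obtain c' where "e \<in> c'" "c' \<in> A" using arcs by blast
    then have "c = c'" using cf A \<open>e \<in> c\<close> circuits_eqI[OF graph_of_inj_fst] by blast
    then show "c \<in> A" using \<open>c' \<in> A\<close> by simp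
  qed
qed

lemma move_along_proper_circuits:
  assumes "finite U" "\<sigma> permutes U" "\<And>v. v \<in> U \<Longrightarrow> \<sigma> v \<noteq> v \<Longrightarrow> f v = \<sigma> v"
  shows "move_along f (circuits (graph_of U \<sigma> - Id)) = \<sigma>"
proof
  fix v
  have "v \<in> fst ` \<Union>(circuits (graph_of U \<sigma> - Id)) \<longleftrightarrow> v \<in> U \<and> \<sigma> v \<noteq> v"
    unfolding permutation_circuits_cover[OF assms(1,2)] by (force simp: graph_of_def)
  then show "move_along f (circuits (graph_of U \<sigma> - Id)) v = \<sigma> v"
    using assms(3)[of v] permutes_not_in[OF assms(2), of v]
    by (cases "v \<in> U \<and> \<sigma> v \<noteq> v") (simp_all only: move_along_def if_True if_False, auto)
qed

section \<open>Exchanging permutations for functions\<close>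

text \<open>
  No \<open>A\<close> qualifies if there is an arc outside \<open>Hz\<close> that lies on no circuit. Otherwise the condition
  on \<open>A\<close> forces it to contain every circuit with an arc outside \<open>Hz\<close>, because circuits are disjoint,
  and lets it contain any of the others. Each circuit inside \<open>Hz\<close> is therefore either chosen or not, which produces the
  factor \<open>1 - y c\<close>.
\<close>

lemma sum_circuit_subsets:
  fixes y :: "('v \<times> 'v) set \<Rightarrow> 'r::comm_ring_1" and Hz :: "('v \<times> 'v) set"
  assumes "finite E" "inj_on fst E"
  defines "C \<equiv> circuits E"
  shows "(\<Sum>A | A \<subseteq> C \<and> E - \<Union>A \<subseteq> Hz. \<Prod>c\<in>A. - y c) =
    (if E - \<Union>C \<subseteq> Hz then (\<Prod>c\<in>{c \<in> C. c \<subseteq> Hz}. 1 - y c) * (\<Prod>c\<in>C - {c \<in> C. c \<subseteq> Hz}. - y c) else 0)"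
proof (cases "E - \<Union>C \<subseteq> Hz")
  case False
  then have "{A. A \<subseteq> C \<and> E - \<Union>A \<subseteq> Hz} = {}" by blast
  then show ?thesis using False by (simp only: if_False sum.empty)
next
  case True
  let ?H = "{c \<in> C. c \<subseteq> Hz}" and ?S = "C - {c \<in> C. c \<subseteq> Hz}"
  have fin: "finite C" using assms finite_circuits by blast
  have iff: "E - \<Union>A \<subseteq> Hz \<longleftrightarrow> ?S \<subseteq> A" if "A \<subseteq> C" for A
  proof
    assume A: "E - \<Union>A \<subseteq> Hz"
    show "?S \<subseteq> A"
    proof
      fix c assume c: "c \<in> ?S"
      then obtain e where e: "e \<in> c" "e \<notin> Hz" by blast
      then have "e \<in> E" using c circuits_subset unfolding C_def by blast
      then obtain c' where "c' \<in> A" "e \<in> c'" using A e by blast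
      then show "c \<in> A"
        using circuits_eqI[OF assms(2), of c c' e] c e that unfolding C_def by blast
    qed
  next
    assume "?S \<subseteq> A"
    then show "E - \<Union>A \<subseteq> Hz" using True by blast
  qed
  have "(\<Sum>A | A \<subseteq> C \<and> E - \<Union>A \<subseteq> Hz. \<Prod>c\<in>A. - y c) = (\<Sum>B\<in>Pow ?H. \<Prod>c\<in>B \<union> ?S. - y c)"
  proof (rule sum.reindex_bij_witness[of _ "\<lambda>B. B \<union> ?S" "\<lambda>A. A \<inter> ?H"])
    fix A assume "A \<in> {A. A \<subseteq> C \<and> E - \<Union>A \<subseteq> Hz}"
    then have A: "A \<subseteq> C" "?S \<subseteq> A" using iff by auto
    then show eq: "A \<inter> ?H \<union> ?S = A" by blast
    then show "(\<Prod>c\<in>A \<inter> ?H \<union> ?S. - y c) = (\<Prod>c\<in>A. - y c)" by simp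
  next
    fix B assume B: "B \<in> Pow ?H"
    then show "(B \<union> ?S) \<inter> ?H = B" by blast
    have "B \<union> ?S \<subseteq> C" using B by blast
    then show "B \<union> ?S \<in> {A. A \<subseteq> C \<and> E - \<Union>A \<subseteq> Hz}" using iff by blast
  qed blast
  also have "\<dots> = (\<Sum>B\<in>Pow ?H. (\<Prod>c\<in>B. - y c) * (\<Prod>c\<in>?S. - y c))"
  proof (rule sum.cong[OF refl])
    fix B assume B: "B \<in> Pow ?H"
    then have "finite B" using fin by (auto intro: finite_subset)
    then show "(\<Prod>c\<in>B \<union> ?S. - y c) = (\<Prod>c\<in>B. - y c) * (\<Prod>c\<in>?S. - y c)"
      using B fin by (intro prod.union_disjoint) auto
  qed
  also have "\<dots> = (\<Sum>B\<in>Pow ?H. \<Prod>c\<in>B. - y c) * (\<Prod>c\<in>?S. - y c)"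
    by (simp add: sum_distrib_right)
  also have "(\<Sum>B\<in>Pow ?H. \<Prod>c\<in>B. - y c) = (\<Prod>c\<in>?H. - y c + 1)"
    using fin by (subst prod_add) auto
  finally show ?thesis using True by (simp add: add.commute)
qed

text \<open>
  The combinatorial core. Each fixed point of \<open>\<sigma>\<close> carries a sum over horizontal targets; expanding the
  product of these sums chooses a target for every fixed point, and together with \<open>\<sigma>\<close> on the moved
  points this is a function \<open>f\<close> on \<open>U\<close>. Now the roles are exchanged: for a given \<open>f\<close>, the
  permutations from which it arises correspond to the sets \<open>A\<close> of circuits of \<open>f\<close> outside of which \<open>f\<close>
  is horizontal.
\<close>

lemma sum_permutations_eq_sum_functions:
  fixes x :: "'v \<times> 'v \<Rightarrow> 'r::comm_ring_1" and y :: "('v \<times> 'v) set \<Rightarrow> 'r"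
    and Hz :: "('v \<times> 'v) set" and T :: "'v \<Rightarrow> 'v set"
  assumes fin: "finite U" and finT: "\<And>v. v \<in> U \<Longrightarrow> finite (T v)"
    and irrefl: "\<And>v. v \<in> U \<Longrightarrow> v \<notin> T v"
  shows "(\<Sum>\<sigma> | \<sigma> permutes U.
      (\<Prod>c\<in>circuits (graph_of U \<sigma> - Id). - y c) *
      (\<Prod>v\<in>U. \<Sum>w\<in>(if \<sigma> v = v then {w \<in> T v. (v, w) \<in> Hz} else T v \<inter> {\<sigma> v}). x (v, w))) =
    (\<Sum>f | f \<in> Pi\<^sub>E U T \<and> graph_of U f - \<Union>(circuits (graph_of U f)) \<subseteq> Hz.
      (\<Prod>v\<in>U. x (v, f v)) *
      ((\<Prod>c\<in>{c \<in> circuits (graph_of U f). c \<subseteq> Hz}. 1 - y c) *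
       (\<Prod>c\<in>circuits (graph_of U f) - {c \<in> circuits (graph_of U f). c \<subseteq> Hz}. - y c)))"
    (is "?L = ?R")
proof -
  let ?T = "\<lambda>\<sigma> v. if \<sigma> v = v then {w \<in> T v. (v, w) \<in> Hz} else T v \<inter> {\<sigma> v}"
  let ?ok = "\<lambda>\<sigma> f. \<forall>v\<in>U. if \<sigma> v = v then (v, f v) \<in> Hz else f v = \<sigma> v"
  let ?C = "\<lambda>f. circuits (graph_of U f)"
  let ?Y = "\<lambda>\<sigma>. \<Prod>c\<in>circuits (graph_of U \<sigma> - Id). - y c"
  let ?Z = "\<lambda>f. (\<Prod>c\<in>{c \<in> ?C f. c \<subseteq> Hz}. 1 - y c) * (\<Prod>c\<in>?C f - {c \<in> ?C f. c \<subseteq> Hz}. - y c)"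
  have finP: "finite {\<sigma>. \<sigma> permutes U}" and finF: "finite (Pi\<^sub>E U T)"
    using fin finT by (simp_all add: finite_permutations finite_PiE)
  have "?L = (\<Sum>\<sigma> | \<sigma> permutes U. \<Sum>f | f \<in> Pi\<^sub>E U T \<and> ?ok \<sigma> f. ?Y \<sigma> * (\<Prod>v\<in>U. x (v, f v)))"
  proof (rule sum.cong[OF refl])
    fix \<sigma>
    have mem: "f v \<in> ?T \<sigma> v \<longleftrightarrow> f v \<in> T v \<and> (if \<sigma> v = v then (v, f v) \<in> Hz else f v = \<sigma> v)" for f v
      by auto
    have "(\<Prod>v\<in>U. \<Sum>w\<in>?T \<sigma> v. x (v, w)) = (\<Sum>f\<in>Pi\<^sub>E U (?T \<sigma>). \<Prod>v\<in>U. x (v, f v))"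
      by (rule prod_sum_PiE[OF fin]) (use finT in simp)
    also have "Pi\<^sub>E U (?T \<sigma>) = {f \<in> Pi\<^sub>E U T. ?ok \<sigma> f}"
    proof (rule Set.set_eqI)
      fix f
      have "(\<forall>v\<in>U. f v \<in> ?T \<sigma> v) \<longleftrightarrow> (\<forall>v\<in>U. f v \<in> T v) \<and> ?ok \<sigma> f"
        unfolding mem by blast
      then show "f \<in> Pi\<^sub>E U (?T \<sigma>) \<longleftrightarrow> f \<in> {f \<in> Pi\<^sub>E U T. ?ok \<sigma> f}"
        unfolding PiE_iff mem_Collect_eq by argo
    qed
    finally show "?Y \<sigma> * (\<Prod>v\<in>U. \<Sum>w\<in>?T \<sigma> v. x (v, w)) =
        (\<Sum>f | f \<in> Pi\<^sub>E U T \<and> ?ok \<sigma> f. ?Y \<sigma> * (\<Prod>v\<in>U. x (v, f v)))"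
      by (simp add: sum_distrib_left)
  qed
  also have "\<dots> = (\<Sum>f\<in>Pi\<^sub>E U T. \<Sum>\<sigma> | \<sigma> \<in> {\<sigma>. \<sigma> permutes U} \<and> ?ok \<sigma> f. ?Y \<sigma> * (\<Prod>v\<in>U. x (v, f v)))"
    using sum.swap_restrict[OF finP finF] by simp
  also have "\<dots> = (\<Sum>f\<in>Pi\<^sub>E U T. if graph_of U f - \<Union>(?C f) \<subseteq> Hz then (\<Prod>v\<in>U. x (v, f v)) * ?Z f else 0)"
  proof (rule sum.cong[OF refl])
    fix f assume f: "f \<in> Pi\<^sub>E U T"
    have nofix: "f v \<noteq> v" if "v \<in> U" for v
      using f irrefl[OF that] PiE_mem[OF f that] by auto
    have "(\<Sum>\<sigma> | \<sigma> \<in> {\<sigma>. \<sigma> permutes U} \<and> ?ok \<sigma> f. ?Y \<sigma>) =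
        (\<Sum>A | A \<subseteq> ?C f \<and> graph_of U f - \<Union>A \<subseteq> Hz. \<Prod>c\<in>A. - y c)"
    proof (rule sum.reindex_bij_witness[of _ "move_along f" "\<lambda>\<sigma>. circuits (graph_of U \<sigma> - Id)"])
      fix \<sigma> assume "\<sigma> \<in> {\<sigma>. \<sigma> \<in> {\<sigma>. \<sigma> permutes U} \<and> ?ok \<sigma> f}"
      then have \<sigma>: "\<sigma> permutes U" "?ok \<sigma> f" by auto
      show "move_along f (circuits (graph_of U \<sigma> - Id)) = \<sigma>"
        by (rule move_along_proper_circuits[OF fin \<sigma>(1)]) (use \<sigma>(2) in auto)
      have sub: "graph_of U \<sigma> - Id \<subseteq> graph_of U f"
      proof
        fix e assume "e \<in> graph_of U \<sigma> - Id"
        then obtain v where v: "e = (v, \<sigma> v)" "v \<in> U" "v \<noteq> \<sigma> v"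
          by (auto simp: graph_of_def)
        then have "f v = \<sigma> v" using \<sigma>(2) by metis
        then show "e \<in> graph_of U f" using v by simp
      qed
      have "graph_of U f - (graph_of U \<sigma> - Id) \<subseteq> Hz"
        using \<sigma>(2) by (auto simp: graph_of_def split: if_splits)
      then show "circuits (graph_of U \<sigma> - Id) \<in> {A. A \<subseteq> ?C f \<and> graph_of U f - \<Union>A \<subseteq> Hz}"
        using circuits_mono[OF sub] permutation_circuits_cover[OF fin \<sigma>(1)] by simp
    next
      fix A assume "A \<in> {A. A \<subseteq> ?C f \<and> graph_of U f - \<Union>A \<subseteq> Hz}"
      then have A: "A \<subseteq> ?C f" "graph_of U f - \<Union>A \<subseteq> Hz" by auto
      show "circuits (graph_of U (move_along f A) - Id) = A"
        by (rule proper_circuits_move_along[OF nofix A(1)])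
      have "?ok (move_along f A) f"
      proof
        fix v assume v: "v \<in> U"
        have "(v, f v) \<in> graph_of U f" using v by simp
        moreover have "v \<notin> fst ` \<Union>A \<Longrightarrow> (v, f v) \<notin> \<Union>A" by (metis fst_conv imageI)
        ultimately show "if move_along f A v = v then (v, f v) \<in> Hz else f v = move_along f A v"
          using A(2) nofix[OF v] unfolding move_along_def by (auto simp del: mem_graph_of)
      qed
      then show "move_along f A \<in> {\<sigma>. \<sigma> \<in> {\<sigma>. \<sigma> permutes U} \<and> ?ok \<sigma> f}"
        using move_along_permutes[OF fin A(1)] by simp
    qed simp
    also have "\<dots> = (if graph_of U f - \<Union>(?C f) \<subseteq> Hz then ?Z f else 0)"
      by (rule sum_circuit_subsets[OF finite_graph_of[OF fin] graph_of_inj_fst])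
    finally have eq: "(\<Sum>\<sigma> | \<sigma> \<in> {\<sigma>. \<sigma> permutes U} \<and> ?ok \<sigma> f. ?Y \<sigma>) =
        (if graph_of U f - \<Union>(?C f) \<subseteq> Hz then ?Z f else 0)" .
    show "(\<Sum>\<sigma> | \<sigma> \<in> {\<sigma>. \<sigma> permutes U} \<and> ?ok \<sigma> f. ?Y \<sigma> * (\<Prod>v\<in>U. x (v, f v))) =
        (if graph_of U f - \<Union>(?C f) \<subseteq> Hz then (\<Prod>v\<in>U. x (v, f v)) * ?Z f else 0)"
      unfolding sum_distrib_right[symmetric] eq by (simp add: mult_ac)
  qed
  also have "\<dots> = ?R"
    using finF by (simp only: sum.inter_filter)
  finally show ?thesis .
qed

section \<open>Coefficientwise images of products of monomials\<close>

lemma map_zero: "Poly_Mapping.map f 0 = 0"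
  by (rule poly_mapping_eqI) (simp add: Poly_Mapping.map.rep_eq)

lemma map_sum_of_additive:
  assumes "additive \<tau>"
  shows "Poly_Mapping.map \<tau> (\<Sum>i\<in>I. p i) = (\<Sum>i\<in>I. Poly_Mapping.map \<tau> (p i))"
proof -
  have zero: "\<tau> 0 = 0" by (rule additive.zero[OF assms])
  have add: "Poly_Mapping.map \<tau> (a + b) = Poly_Mapping.map \<tau> a + Poly_Mapping.map \<tau> b" for a b
    by (rule poly_mapping_eqI)
       (simp add: Poly_Mapping.map.rep_eq lookup_add when_def zero flip: additive.add[OF assms])
  show ?thesis
    by (induction I rule: infinite_finite_induct) (simp_all add: map_zero add)
qed

lemma map_indet:
  assumes "\<tau> 0 = 0" "\<tau> 1 = 1"
  shows "Poly_Mapping.map \<tau> (indet i j) = indet i j"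
  unfolding indet_def using assms by (subst map_single) simp_all

text \<open>
  The indeterminates are central, so that the noncommutative product only affects the coefficients.
\<close>

lemma prod_list_monomials:
  fixes g :: "'a \<Rightarrow> 'h::ring_1" and \<mu> :: "'a \<Rightarrow> ((nat \<times> nat) \<Rightarrow>\<^sub>0 nat)"
  shows "prod_list (map (\<lambda>e. - (Const (g e) * Poly_Mapping.single (\<mu> e) 1)) p) =
    Poly_Mapping.single (sum_list (map \<mu> p)) ((-1) ^ length p * prod_list (map g p))"
proof (induction p)
  case Nil
  then show ?case by simp
next
  case (Cons e p)
  have "- g e * ((-1) ^ length p * prod_list (map g p)) = (-1) ^ length (e # p) * prod_list (map g (e # p))"
    by (cases "even (length p)") simp_all
  moreover have "- (Const (g e) * Poly_Mapping.single (\<mu> e) 1) = Poly_Mapping.single (\<mu> e) (- g e)"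
    by (simp add: Const_def mult_single single_uminus)
  ultimately show ?case
    using Cons by (simp add: mult_single)
qed

lemma map_prod_list_monomials:
  fixes \<tau> :: "'h::ring_1 \<Rightarrow> 'k::comm_ring_1" and \<mu> :: "'a \<Rightarrow> ((nat \<times> nat) \<Rightarrow>\<^sub>0 nat)"
  assumes "additive \<tau>" "distinct p"
  shows "Poly_Mapping.map \<tau> (prod_list (map (\<lambda>e. - (Const (g e) * Poly_Mapping.single (\<mu> e) 1)) p)) =
    (-1) ^ length p * Const (\<tau> (prod_list (map g p))) * (\<Prod>e\<in>set p. Poly_Mapping.single (\<mu> e) 1)"
proof -
  have zero: "\<tau> 0 = 0" by (rule additive.zero[OF assms(1)])
  have "(\<Prod>e\<in>set p. Poly_Mapping.single (\<mu> e) (1::'k)) = prod_list (map (\<lambda>e. Poly_Mapping.single (\<mu> e) 1) p)"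
    using assms(2) by (rule prod.distinct_set_conv_list)
  also have "\<dots> = Poly_Mapping.single (sum_list (map \<mu> p)) 1"
    by (induction p) (simp_all add: mult_single)
  finally have prod: "(\<Prod>e\<in>set p. Poly_Mapping.single (\<mu> e) (1::'k)) = Poly_Mapping.single (sum_list (map \<mu> p)) 1" .
  have "\<tau> ((-1) ^ length p * prod_list (map g p)) = (-1) ^ length p * \<tau> (prod_list (map g p))"
    by (cases "even (length p)") (simp_all add: additive.minus[OF assms(1)])
  moreover have "Poly_Mapping.single k ((-1) ^ i * a) = (-1) ^ i * Poly_Mapping.single k a"
    for k :: "(nat \<times> nat) \<Rightarrow>\<^sub>0 nat" and a :: 'k and i
    by (cases "even i") (simp_all add: single_uminus)
  ultimately show ?thesis
    unfolding prod_list_monomials prod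
    by (subst map_single) (simp_all add: zero Const_def mult_single mult.assoc)
qed

lemma prod_list_eq_0: "0 \<in> set xs \<Longrightarrow> prod_list xs = (0::'a::semiring_1)"
  by (induction xs) auto

lemma circuit_prod_loop: "circuit_prod w {(v, v)} = w (v, v)"
proof -
  have only: "p = [(v, v)]" if "arc_circuit p" "set p = {(v, v)}" for p
    using arc_circuit_distinct[OF that(1)] that(2) by (cases p; cases "tl p") auto
  have "(SOME p. arc_circuit p \<and> set p = {(v, v)}) = [(v, v)]"
  proof (rule some_equality)
    show "arc_circuit [(v, v)] \<and> set [(v, v)] = {(v, v)}" by (simp add: arc_circuit_def)
  qed (use only in blast)
  then show ?thesis by (simp add: circuit_prod_def)
qed

section \<open>The terms of the determinant\<close>

definition position :: "nat \<Rightarrow> nat \<Rightarrow> vertex" where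
  "position N v = (v div N, v mod N)"

text \<open>
  The indices that can be reached by an arc from the index \<open>v\<close>, those of the well included.
\<close>

definition targets :: "nat \<Rightarrow> nat \<Rightarrow> nat \<Rightarrow> nat set" where
  "targets n N v = {w. w < N * n \<and> w div N \<noteq> v div N}"

lemma Delta_block_entry:
  assumes "\<And>i j. (i, j) \<in> edges n \<Longrightarrow> h i j \<in> carrier_mat N N"
    and "i < n" "j < n" "k < N" "l < N"
  shows "Delta_block n N h i j $$ (k, l) =
    (if i = j then if k = l then \<Sum>l\<in>{..<n} - {i}. indet i l else 0
     else - (Const (h i j $$ (k, l)) * indet i j))"
proof (cases "i = j")
  case True
  then show ?thesis using assms by (simp add: Delta_block_def)
next
  case False
  then have "h i j \<in> carrier_mat N N" using assms by (simp add: edges_def)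
  then show ?thesis using False assms(4,5) by (auto simp: Delta_block_def)
qed

lemma leading_Delta_entry:
  assumes "m \<le> n" "\<And>i j. (i, j) \<in> edges n \<Longrightarrow> h i j \<in> carrier_mat N N"
    and "v < N * m" "w < N * m"
  shows "leading_submatrix (N * m) (Delta n N h) $$ (v, w) =
    (if v = w then \<Sum>l\<in>{..<n} - {v div N}. indet (v div N) l
     else if w \<in> targets n N v
     then - (Const (hat_h h (position N v, position N w)) * indet (v div N) (w div N))
     else 0)"
proof -
  have N: "0 < N" using assms(3) by (cases N) auto
  have le: "N * m \<le> N * n" using assms(1) by simp
  have vw: "v < N * n" "w < N * n" using assms(3,4) le by linarith+
  then have divs: "v div N < n" "w div N < n" by (simp_all add: less_mult_imp_div_less mult.commute)
  have eq: "v = w \<longleftrightarrow> v div N = w div N \<and> v mod N = w mod N"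
    by (metis div_mult_mod_eq)
  have "leading_submatrix (N * m) (Delta n N h) $$ (v, w) =
      Delta_block n N h (v div N) (w div N) $$ (v mod N, w mod N)"
    using assms(3,4) vw by (simp add: leading_submatrix_def Delta_def)
  also have "\<dots> = (if v div N = w div N then
      (if v mod N = w mod N then \<Sum>l\<in>{..<n} - {v div N}. indet (v div N) l else 0)
      else - (Const (hat_h h (position N v, position N w)) * indet (v div N) (w div N)))"
    using N divs Delta_block_entry[where h = h, OF assms(2)]
    by (simp only: hat_h_def position_def prod.case mod_less_divisor)
  finally show ?thesis using eq vw by (auto simp: targets_def)
qed

lemma cycles_perm_digraph: "cycles (perm_digraph p \<sigma>) = circuits (graph_of {..<p} \<sigma>)"
  and cycle_prod_perm_digraph:
    "c \<in> circuits (graph_of {..<p} \<sigma>) \<Longrightarrow> cycle_prod (perm_digraph p \<sigma>) w c = circuit_prod w c"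
proof -
  have arcs: "parcs (perm_digraph p \<sigma>) = graph_of {..<p} \<sigma>"
    by (auto simp: perm_digraph_def graph_of_def)
  moreover have wf: "fst ` parcs (perm_digraph p \<sigma>) \<subseteq> pverts (perm_digraph p \<sigma>)"
    by (auto simp: perm_digraph_def)
  ultimately show "cycles (perm_digraph p \<sigma>) = circuits (graph_of {..<p} \<sigma>)"
    using cycles_eq_circuits by metis
  show "c \<in> circuits (graph_of {..<p} \<sigma>) \<Longrightarrow> cycle_prod (perm_digraph p \<sigma>) w c = circuit_prod w c"
    using cycle_prod_eq_circuit_prod[OF wf] arcs by metis
qed

text \<open>
  Any \<open>\<sigma>\<close> is \<open>move_along \<sigma>\<close> of its own proper circuits.
\<close>

lemma sign_eq_prod_circuits:
  assumes "finite U" "\<sigma> permutes U"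
  shows "sign \<sigma> = (\<Prod>c\<in>circuits (graph_of U \<sigma> - Id). - ((-1) ^ card c))"
proof -
  have "sign \<sigma> = sign (move_along \<sigma> (circuits (graph_of U \<sigma> - Id)))"
    using move_along_proper_circuits[OF assms, of \<sigma>] by simp
  also have "\<dots> = (\<Prod>c\<in>circuits (graph_of U \<sigma> - Id). - ((-1) ^ card c))"
    by (rule sign_move_along[OF assms(1)]) (intro circuits_mono Diff_subset)
  finally show ?thesis .
qed

text \<open>
  Two distinct indices in the same block give the entry \<open>0\<close>, which kills the product; this is what the
  default \<open>0\<close> on the right-hand side records. The sign \<open>(-1) ^ card c\<close> collects the signs of the
  entries \<open>- h\<^sub>i\<^sub>j a\<^sub>i\<^sub>j\<close>.
\<close>

lemma map_circuit_prod_Delta: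
  fixes \<tau> :: "'h::ring_1 \<Rightarrow> 'k::comm_ring_1"
  assumes "additive \<tau>" "m \<le> n" "\<And>i j. (i, j) \<in> edges n \<Longrightarrow> h i j \<in> carrier_mat N N"
    and c: "c \<in> circuits ({..<N * m} \<times> {..<N * m} - Id)"
  shows "Poly_Mapping.map \<tau> (circuit_prod (\<lambda>e. leading_submatrix (N * m) (Delta n N h) $$ e) c) =
    (-1) ^ card c * Const (\<tau> (circuit_prod (\<lambda>(v, w). hat_h h (position N v, position N w)) c)) *
    (\<Prod>(v, w)\<in>c. if w \<in> targets n N v then indet (v div N) (w div N) else 0)"
proof -
  let ?M = "\<lambda>e. leading_submatrix (N * m) (Delta n N h) $$ e"
  let ?g = "\<lambda>(v, w). hat_h h (position N v, position N w)"
  let ?mu = "\<lambda>(v, w). Poly_Mapping.single (v div N, w div N) (1::nat)"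
  let ?x = "\<lambda>(v, w). if w \<in> targets n N v then indet (v div N) (w div N) else (0::'k mpoly)"
  define p where "p = (SOME p. arc_circuit p \<and> set p = c)"
  have p: "arc_circuit p" "set p = c"
    using someI_ex[of "\<lambda>p. arc_circuit p \<and> set p = c"] c unfolding p_def circuits_def by blast+
  have arcs: "v < N * m" "w < N * m" "v \<noteq> w" if "(v, w) \<in> c" for v w
    using circuits_subset[OF c] that by auto
  have fin: "finite c" using p by auto
  show ?thesis
  proof (cases "\<forall>(v, w)\<in>c. w \<in> targets n N v")
    case True
    have M: "?M e = - (Const (?g e) * Poly_Mapping.single (?mu e) 1)" if "e \<in> c" for e
    proof (cases e)
      case (Pair v w)
      then show ?thesis
        using leading_Delta_entry[where h = h, OF assms(2,3) arcs(1,2)[of v w]] arcs(3)[of v w] that True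
        by (auto simp: indet_def)
    qed
    have "map ?M p = map (\<lambda>e. - (Const (?g e) * Poly_Mapping.single (?mu e) 1)) p"
      using M p(2) by (intro map_cong) auto
    then have "Poly_Mapping.map \<tau> (circuit_prod ?M c) =
        (-1) ^ length p * Const (\<tau> (prod_list (map ?g p))) * (\<Prod>e\<in>set p. Poly_Mapping.single (?mu e) 1)"
      unfolding circuit_prod_def p_def[symmetric]
      using map_prod_list_monomials[OF assms(1) arc_circuit_distinct[OF p(1)], of ?g ?mu] by argo
    also have "length p = card c"
      using arc_circuit_distinct[OF p(1)] p(2) distinct_card by metis
    also have "prod_list (map ?g p) = circuit_prod ?g c"
      by (simp add: circuit_prod_def p_def)
    also have "(\<Prod>e\<in>set p. Poly_Mapping.single (?mu e) 1) = (\<Prod>e\<in>c. ?x e)"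
      unfolding p(2) using True by (intro prod.cong) (auto simp: indet_def)
    finally show ?thesis .
  next
    case False
    then obtain v w where e: "(v, w) \<in> c" "w \<notin> targets n N v" by blast
    then have "?M (v, w) = 0"
      using leading_Delta_entry[where h = h, OF assms(2,3) arcs(1,2)[of v w]] arcs(3)[of v w] by simp
    then have "prod_list (map ?M p) = 0"
      using e(1) p(2) by (intro prod_list_eq_0) (auto intro!: rev_image_eqI)
    then have "circuit_prod ?M c = 0" by (simp add: circuit_prod_def p_def)
    moreover have "(\<Prod>e\<in>c. ?x e) = 0"
      using e fin by (intro prod_zero bexI[of _ "(v, w)"]) auto
    ultimately show ?thesis by (simp add: map_zero)
  qed
qed

text \<open>
  A horizontal target keeps the colour \<open>v mod N\<close> and is thus given by its block.
\<close>

lemma sum_horizontal_targets: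
  assumes "0 < N"
  shows "(\<Sum>w\<in>{w \<in> targets n N v. v mod N = w mod N}. g (w div N)) = (\<Sum>l\<in>{..<n} - {v div N}. g l)"
proof (rule sum.reindex_bij_witness[of _ "\<lambda>l. N * l + v mod N" "\<lambda>w. w div N"])
  fix w assume w: "w \<in> {w \<in> targets n N v. v mod N = w mod N}"
  then show "N * (w div N) + v mod N = w" by simp
  show "w div N \<in> {..<n} - {v div N}"
    using w by (auto simp: targets_def less_mult_imp_div_less mult.commute)
next
  fix l assume l: "l \<in> {..<n} - {v div N}"
  show "(N * l + v mod N) div N = l" using assms by simp
  have "N * l + v mod N < N * (l + 1)" using assms by simp
  also have "\<dots> \<le> N * n" using l by (intro mult_le_mono2) auto
  finally show "N * l + v mod N \<in> {w \<in> targets n N v. v mod N = w mod N}"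
    using l assms by (simp add: targets_def)
qed simp

text \<open>
  A circuit \<open>c\<close> of length at least two contributes \<open>- (-1) ^ card c\<close> through the signature and
  \<open>(-1) ^ card c\<close> through its entries, which leaves one minus sign per circuit. A fixed point
  contributes a diagonal entry, whose image is the sum of the indeterminates of its horizontal targets
  because \<open>\<tau> 1 = 1\<close>.
\<close>

lemma det_tau_term:
  fixes \<tau> :: "'h::ring_1 \<Rightarrow> 'k::comm_ring_1"
  assumes "m \<le> n" "1 \<le> N" "additive \<tau>" "\<tau> 1 = 1"
    and h: "\<And>i j. (i, j) \<in> edges n \<Longrightarrow> h i j \<in> carrier_mat N N"
    and \<sigma>: "\<sigma> permutes {..<N * m}"
  defines "U \<equiv> {..<N * m}"
  defines "M \<equiv> leading_submatrix (N * m) (Delta n N h)"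
  shows "of_int (sign \<sigma>) * (\<Prod>c\<in>cycles (perm_digraph (N * m) \<sigma>).
      Poly_Mapping.map \<tau> (cycle_prod (perm_digraph (N * m) \<sigma>) (\<lambda>e. M $$ e) c)) =
    (\<Prod>c\<in>circuits (graph_of U \<sigma> - Id).
      - Const (\<tau> (circuit_prod (\<lambda>(v, w). hat_h h (position N v, position N w)) c))) *
    (\<Prod>v\<in>U. \<Sum>w\<in>(if \<sigma> v = v then {w \<in> targets n N v. (v, w) \<in> {(v, w). v mod N = w mod N}}
        else targets n N v \<inter> {\<sigma> v}). (\<lambda>(v, w). indet (v div N) (w div N)) (v, w))"
proof -
  let ?E = "graph_of U \<sigma>"
  let ?P = "circuits (?E - Id)"
  let ?m = "\<lambda>c. Poly_Mapping.map \<tau> (circuit_prod (\<lambda>e. M $$ e) c)"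
  let ?y = "\<lambda>c. Const (\<tau> (circuit_prod (\<lambda>(v, w). hat_h h (position N v, position N w)) c))"
  let ?x = "\<lambda>(v, w). if w \<in> targets n N v then indet (v div N) (w div N) else (0::'k mpoly)"
  let ?s = "\<lambda>v. \<Sum>l\<in>{..<n} - {v div N}. indet (v div N) l :: 'k mpoly"
  \<comment> \<open>One weight for all arcs of the graph of \<open>\<sigma>\<close>, so that loops and proper circuits recombine into
    a single product over the vertices.\<close>
  let ?loc = "\<lambda>e. if e \<in> Id then ?s (fst e) else ?x e"
  have U: "finite U" "\<sigma> permutes U" using \<sigma> by (simp_all add: U_def)
  have finE: "finite ?E" using U finite_graph_of by blast
  have finP: "finite ?P" using finE finite_circuits by blast
  have EU: "?E \<subseteq> U \<times> U" using permutes_in_image[OF U(2)] by (auto simp: graph_of_def)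
  have tau0: "\<tau> 0 = 0" by (rule additive.zero[OF assms(3)])
  have "(\<Prod>c\<in>cycles (perm_digraph (N * m) \<sigma>).
      Poly_Mapping.map \<tau> (cycle_prod (perm_digraph (N * m) \<sigma>) (\<lambda>e. M $$ e) c)) = (\<Prod>c\<in>circuits ?E. ?m c)"
    unfolding cycles_perm_digraph U_def by (intro prod.cong) (simp_all add: cycle_prod_perm_digraph)
  also have "\<dots> = (\<Prod>c\<in>?P. ?m c) * (\<Prod>c\<in>(\<lambda>e. {e}) ` (?E \<inter> Id). ?m c)"
    unfolding circuits_split_loops[OF graph_of_inj_fst, of U \<sigma>]
    using finP finE circuits_subset by (intro prod.union_disjoint) blast+
  also have "(\<Prod>c\<in>(\<lambda>e. {e}) ` (?E \<inter> Id). ?m c) = (\<Prod>e\<in>?E \<inter> Id. ?loc e)"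
  proof (subst prod.reindex)
    show "prod (?m \<circ> (\<lambda>e. {e})) (?E \<inter> Id) = (\<Prod>e\<in>?E \<inter> Id. ?loc e)"
    proof (rule prod.cong[OF refl])
      fix e assume "e \<in> ?E \<inter> Id"
      then obtain v where v: "e = (v, v)" "v < N * m" by (auto simp: U_def graph_of_def)
      have "?m {e} = Poly_Mapping.map \<tau> (\<Sum>l\<in>{..<n} - {v div N}. indet (v div N) l)"
        using leading_Delta_entry[where h = h, OF assms(1) h v(2) v(2)] v(1)
        by (simp add: circuit_prod_loop M_def)
      also have "\<dots> = ?s v"
        by (simp add: map_sum_of_additive[OF assms(3)] map_indet[OF tau0 assms(4)])
      finally show "(?m \<circ> (\<lambda>e. {e})) e = ?loc e" using v by simp
    qed
  qed simp
  finally have cyc: "(\<Prod>c\<in>cycles (perm_digraph (N * m) \<sigma>).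
      Poly_Mapping.map \<tau> (cycle_prod (perm_digraph (N * m) \<sigma>) (\<lambda>e. M $$ e) c)) =
      (\<Prod>c\<in>?P. ?m c) * (\<Prod>e\<in>?E \<inter> Id. ?loc e)" .
  have sign: "of_int (sign \<sigma>) = (\<Prod>c\<in>?P. - ((-1) ^ card c) :: 'k mpoly)"
    unfolding sign_eq_prod_circuits[OF U] by simp
  have "of_int (sign \<sigma>) * (\<Prod>c\<in>?P. ?m c) = (\<Prod>c\<in>?P. - ?y c * (\<Prod>e\<in>c. ?loc e))"
    unfolding sign prod.distrib[symmetric]
  proof (rule prod.cong[OF refl])
    fix c assume c: "c \<in> ?P"
    have c': "c \<in> circuits ({..<N * m} \<times> {..<N * m} - Id)"
      using c EU circuits_mono[of "?E - Id" "U \<times> U - Id"] by (auto simp: U_def)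
    have "?m c = (-1) ^ card c * ?y c * (\<Prod>e\<in>c. ?x e)"
      unfolding M_def by (rule map_circuit_prod_Delta[OF assms(3,1) _ c']) (rule h)
    also have "(\<Prod>e\<in>c. ?x e) = (\<Prod>e\<in>c. ?loc e)"
      using circuits_subset[OF c] by (intro prod.cong) auto
    finally have "- ((-1) ^ card c) * ?m c = - ((-1) ^ card c * (-1) ^ card c) * ?y c * (\<Prod>e\<in>c. ?loc e)"
      by (simp only: mult.assoc minus_mult_left[symmetric])
    then show "- ((-1) ^ card c) * ?m c = - ?y c * (\<Prod>e\<in>c. ?loc e)"
      by (simp add: power_mult_distrib[symmetric])
  qed
  also have "\<dots> = (\<Prod>c\<in>?P. - ?y c) * (\<Prod>c\<in>?P. \<Prod>e\<in>c. ?loc e)"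
    by (rule prod.distrib)
  also have "(\<Prod>c\<in>?P. \<Prod>e\<in>c. ?loc e) = (\<Prod>e\<in>\<Union>?P. ?loc e)"
  proof (rule prod.Union_disjoint[symmetric, unfolded comp_def])
    show "\<forall>A\<in>?P. finite A" using circuits_finite by blast
    have "inj_on fst (?E - Id)" using graph_of_inj_fst inj_on_diff by blast
    then show "\<forall>A\<in>?P. \<forall>B\<in>?P. A \<noteq> B \<longrightarrow> A \<inter> B = {}"
      using circuits_eqI by blast
  qed
  also have "\<Union>?P = ?E - Id" by (rule permutation_circuits_cover[OF U])
  finally have proper: "of_int (sign \<sigma>) * (\<Prod>c\<in>?P. ?m c) =
      (\<Prod>c\<in>?P. - ?y c) * (\<Prod>e\<in>?E - Id. ?loc e)" .
  have "of_int (sign \<sigma>) * ((\<Prod>c\<in>?P. ?m c) * (\<Prod>e\<in>?E \<inter> Id. ?loc e)) =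
      (of_int (sign \<sigma>) * (\<Prod>c\<in>?P. ?m c)) * (\<Prod>e\<in>?E \<inter> Id. ?loc e)"
    by (rule mult.assoc[symmetric])
  also have "\<dots> = (\<Prod>c\<in>?P. - ?y c) * ((\<Prod>e\<in>?E \<inter> Id. ?loc e) * (\<Prod>e\<in>?E - Id. ?loc e))"
    unfolding proper mult.assoc by (subst mult.commute[of "prod ?loc (?E - Id)"]) (rule refl)
  also have "(\<Prod>e\<in>?E \<inter> Id. ?loc e) * (\<Prod>e\<in>?E - Id. ?loc e) = (\<Prod>e\<in>?E. ?loc e)"
    by (rule prod.Int_Diff[OF finE, symmetric])
  also have "\<dots> = (\<Prod>v\<in>U. ?loc (v, \<sigma> v))"
    unfolding graph_of_def by (subst prod.reindex) (auto simp: inj_on_def)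
  also have "\<dots> = (\<Prod>v\<in>U. \<Sum>w\<in>(if \<sigma> v = v then {w \<in> targets n N v. (v, w) \<in> {(v, w). v mod N = w mod N}}
        else targets n N v \<inter> {\<sigma> v}). (\<lambda>(v, w). indet (v div N) (w div N)) (v, w))"
  proof (rule prod.cong[OF refl])
    fix v
    show "?loc (v, \<sigma> v) = (\<Sum>w\<in>(if \<sigma> v = v then {w \<in> targets n N v. (v, w) \<in> {(v, w). v mod N = w mod N}}
        else targets n N v \<inter> {\<sigma> v}). (\<lambda>(v, w). indet (v div N) (w div N)) (v, w))"
    proof (cases "\<sigma> v = v")
      case True
      then show ?thesis
        using sum_horizontal_targets[of N "indet (v div N) :: nat \<Rightarrow> 'k mpoly" n v] assms(2) by simp
    next
      case False
      then show ?thesis by (cases "\<sigma> v \<in> targets n N v") auto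
    qed
  qed
  finally show ?thesis unfolding cyc .
qed

section \<open>Forests as functions\<close>

lemma inj_position: "inj (position N)"
proof (rule injI)
  fix v w assume "position N v = position N w"
  then have "v div N = w div N" "v mod N = w mod N" by (simp_all add: position_def)
  then show "v = w" by (metis div_mult_mod_eq)
qed

lemma position_inverse: "k < N \<Longrightarrow> position N (N * i + k) = (i, k)"
  by (simp add: position_def)

lemma index_less: "i < m \<Longrightarrow> k < N \<Longrightarrow> N * i + k < N * m" for i k m N :: nat
proof -
  assume "i < m" "k < N"
  then have "N * i + k < N * (i + 1)" "N * (i + 1) \<le> N * m" by (simp, intro mult_le_mono2) auto
  then show ?thesis by linarith
qed

text \<open>
  A forest has exactly one arc out of each vertex outside the well, so it is the graph of a function,
  transported from indices to pairs.
\<close>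

definition forest_of :: "nat \<Rightarrow> nat \<Rightarrow> (nat \<Rightarrow> nat) \<Rightarrow> edge set" where
  "forest_of m N f = map_prod (position N) (position N) ` graph_of {..<N * m} f"

lemma inj_map_position: "inj (map_prod (position N) (position N))"
  using inj_position by (simp add: prod.inj_map)

lemma forest_of_in_forests:
  assumes "m \<le> n" "1 \<le> N" and f: "f \<in> Pi\<^sub>E {..<N * m} (targets n N)"
  shows "forest_of m N f \<in> forests n m N"
proof -
  let ?F = "forest_of m N f"
  have F: "?F = (\<lambda>v. (position N v, position N (f v))) ` {..<N * m}"
    by (simp add: forest_of_def graph_of_def image_image)
  have "(position N v, position N (f v)) \<in> hat_edges n N" if "v < N * m" for v
  proof -
    have "f v < N * n" "f v div N \<noteq> v div N"
      using PiE_mem[OF f, of v] that by (auto simp: targets_def)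
    moreover have "v < N * n" using that assms(1) by (meson less_le_trans mult_le_mono2)
    ultimately show ?thesis
      using assms(2) by (auto simp: hat_edges_def edges_def position_def less_mult_imp_div_less mult.commute)
  qed
  then have "?F \<subseteq> hat_edges n N" unfolding F by blast
  moreover have "card ?F = N * m"
    unfolding F by (subst card_image) (auto simp: inj_on_def inj_eq[OF inj_position])
  moreover have "\<exists>!e. e \<in> ?F \<and> fst e = (i, k)" if "i < m" "k < N" for i k
  proof (rule ex1I[of _ "(position N (N * i + k), position N (f (N * i + k)))"])
    show "(position N (N * i + k), position N (f (N * i + k))) \<in> ?F \<and>
        fst (position N (N * i + k), position N (f (N * i + k))) = (i, k)"
      unfolding F using index_less[OF that] position_inverse[OF that(2)]
      by (auto intro!: image_eqI[of _ _ "N * i + k"])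
  next
    fix e assume "e \<in> ?F \<and> fst e = (i, k)"
    then obtain v where v: "e = (position N v, position N (f v))" "position N v = (i, k)"
      unfolding F by auto
    then have "v = N * i + k"
      using position_inverse[OF that(2), of i] injD[OF inj_position] by metis
    then show "e = (position N (N * i + k), position N (f (N * i + k)))" using v by simp
  qed
  ultimately show ?thesis by (auto simp: forests_def)
qed

text \<open>
  Reading off the head of the unique arc out of each vertex gives \<open>f\<close>; since \<open>F\<close> has only \<open>N * m\<close> arcs,
  none of them is left over, in particular none leaves the well.
\<close>

lemma forest_is_forest_of:
  assumes "1 \<le> m" "m \<le> n" "1 \<le> N" and F: "F \<in> forests n m N"
  shows "\<exists>f\<in>Pi\<^sub>E {..<N * m} (targets n N). F = forest_of m N f"
proof -
  have sub: "F \<subseteq> hat_edges n N" and card: "card F = N * m"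
    using F by (simp_all add: forests_def)
  have tails: "\<forall>v\<in>{..<m} \<times> {..<N}. \<exists>!e. e \<in> F \<and> fst e = v"
    using F unfolding forests_def mem_Collect_eq by (elim conjE)
  define g where "g v = (THE e. e \<in> F \<and> fst e = position N v)" for v
  have g: "g v \<in> F" "fst (g v) = position N v" if "v < N * m" for v
  proof -
    have "position N v \<in> {..<m} \<times> {..<N}"
      using that assms(3) by (auto simp: position_def less_mult_imp_div_less mult.commute)
    then have "\<exists>!e. e \<in> F \<and> fst e = position N v" by (rule bspec[OF tails])
    from theI'[OF this] show "g v \<in> F" "fst (g v) = position N v" by (auto simp: g_def)
  qed
  define f where "f = restrict (\<lambda>v. N * fst (snd (g v)) + snd (snd (g v))) {..<N * m}"
  have arc: "(position N v, position N (f v)) = g v" and target: "f v \<in> targets n N v"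
    if v: "v < N * m" for v
  proof -
    obtain j l where jl: "g v = (position N v, (j, l))" using g(2)[OF v] by (metis prod.collapse)
    then have "(position N v, (j, l)) \<in> hat_edges n N" using g(1)[OF v] sub by auto
    then have e: "j < n" "l < N" "v div N \<noteq> j" by (auto simp: hat_edges_def edges_def position_def)
    have fv: "f v = N * j + l" using v jl by (simp add: f_def)
    show "(position N v, position N (f v)) = g v" using jl e by (simp add: fv position_inverse)
    show "f v \<in> targets n N v" using e index_less[OF e(1,2)] by (simp add: fv targets_def)
  qed
  have f: "f \<in> Pi\<^sub>E {..<N * m} (targets n N)"
    using target by (auto simp: f_def PiE_iff)
  have "forest_of m N f \<subseteq> F"
    using arc g(1) by (auto simp: forest_of_def graph_of_def)
  moreover have "finite F" using card assms by (intro card_ge_0_finite) simp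
  moreover have "card (forest_of m N f) = card F"
    using forest_of_in_forests[OF assms(2,3) f] card by (simp add: forests_def)
  ultimately have "F = forest_of m N f" using card_subset_eq by metis
  then show ?thesis using f by blast
qed

lemma inj_on_forest_of: "inj_on (forest_of m N) (Pi\<^sub>E {..<N * m} T)"
proof (rule inj_onI)
  fix f g assume fg: "f \<in> Pi\<^sub>E {..<N * m} T" "g \<in> Pi\<^sub>E {..<N * m} T" "forest_of m N f = forest_of m N g"
  have "graph_of {..<N * m} f = graph_of {..<N * m} g"
    using fg(3) inj_image_eq_iff[OF inj_map_position] by (simp add: forest_of_def)
  then have "f v = g v" if "v \<in> {..<N * m}" for v
    using mem_graph_of that by metis
  then show "f = g" using fg by (intro PiE_ext)
qed

text \<open>
  The second part needs centrality: the circuit and its transported image may be listed from different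
  starting points.
\<close>

lemma cycles_forest_of:
  assumes "forest_of m N f \<in> forests n m N"
  shows "cycles (forest_digraph n N (forest_of m N f)) =
      (`) (map_prod (position N) (position N)) ` circuits (graph_of {..<N * m} f)" (is ?cycles)
    and "\<lbrakk>\<And>x y. \<tau> (x * y) = \<tau> (y * x); c \<in> circuits (graph_of {..<N * m} f)\<rbrakk> \<Longrightarrow>
      \<tau> (forest_holonomy n N h (forest_of m N f) (map_prod (position N) (position N) ` c)) =
      \<tau> (circuit_prod (\<lambda>(v, w). hat_h h (position N v, position N w)) c)"
proof -
  let ?F = "forest_of m N f" and ?P = "map_prod (position N) (position N)"
  have wf: "fst ` parcs (forest_digraph n N ?F) \<subseteq> pverts (forest_digraph n N ?F)"
    using assms by (auto simp: forests_def forest_digraph_def hat_edges_def edges_def)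
  have arcs: "parcs (forest_digraph n N ?F) = ?F" by (simp add: forest_digraph_def)
  have circ: "circuits ?F = (`) ?P ` circuits (graph_of {..<N * m} f)"
    unfolding forest_of_def by (rule circuits_image_inj[OF inj_position])
  then show ?cycles using cycles_eq_circuits[OF wf] arcs by simp
  assume central: "\<And>x y. \<tau> (x * y) = \<tau> (y * x)" and c: "c \<in> circuits (graph_of {..<N * m} f)"
  obtain p where p: "arc_circuit p" "c = set p" using c by (auto simp: circuits_def)
  have Pc: "?P ` c \<in> circuits ?F" using c circ by blast
  have "\<tau> (forest_holonomy n N h ?F (?P ` c)) = \<tau> (circuit_prod (hat_h h) (set (map ?P p)))"
    unfolding forest_holonomy_def
    using cycle_prod_eq_circuit_prod[OF wf, of "?P ` c" "hat_h h"] arcs Pc p(2) by simp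
  also have "\<dots> = \<tau> (prod_list (map (hat_h h) (map ?P p)))"
    by (rule central_circuit_prod[where \<tau> = \<tau>, OF central]) (simp only: arc_circuit_map_inj[OF inj_position] p(1))
  also have "map (hat_h h) (map ?P p) = map (\<lambda>(v, w). hat_h h (position N v, position N w)) p"
    by (simp add: case_prod_beta map_prod_def)
  also have "\<tau> (prod_list \<dots>) = \<tau> (circuit_prod (\<lambda>(v, w). hat_h h (position N v, position N w)) (set p))"
    by (rule central_circuit_prod[where \<tau> = \<tau>, OF central p(1), symmetric])
  finally show "\<tau> (forest_holonomy n N h ?F (?P ` c)) =
      \<tau> (circuit_prod (\<lambda>(v, w). hat_h h (position N v, position N w)) c)"
    by (simp add: p(2))
qed

lemma horizontal_edge_position:
  "horizontal_edge (map_prod (position N) (position N) e) \<longleftrightarrow> e \<in> {(v, w). v mod N = w mod N}"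
  by (cases e) (simp add: horizontal_edge_def position_def)

lemma horizontal_forests_eq:
  assumes "1 \<le> m" "m \<le> n" "1 \<le> N"
  shows "horizontal_forests n m N = forest_of m N `
    {f \<in> Pi\<^sub>E {..<N * m} (targets n N).
      graph_of {..<N * m} f - \<Union>(circuits (graph_of {..<N * m} f)) \<subseteq> {(v, w). v mod N = w mod N}}"
proof -
  let ?P = "map_prod (position N) (position N)" and ?G = "graph_of {..<N * m}"
  have iff: "(\<forall>e\<in>forest_of m N f - \<Union>(cycles (forest_digraph n N (forest_of m N f))). horizontal_edge e) \<longleftrightarrow>
      ?G f - \<Union>(circuits (?G f)) \<subseteq> {(v, w). v mod N = w mod N}"
    if "forest_of m N f \<in> forests n m N" for f
  proof -
    have "forest_of m N f - \<Union>(cycles (forest_digraph n N (forest_of m N f))) = ?P ` (?G f - \<Union>(circuits (?G f)))"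
      unfolding cycles_forest_of(1)[OF that]
      unfolding forest_of_def image_set_diff[OF inj_map_position] image_Union ..
    then show ?thesis by (auto simp: horizontal_edge_position subset_iff simp del: map_prod_simp)
  qed
  have "forests n m N = forest_of m N ` Pi\<^sub>E {..<N * m} (targets n N)"
    using forest_of_in_forests[OF assms(2,3)] forest_is_forest_of[OF assms] by blast
  then have "horizontal_forests n m N = forest_of m N ` {f \<in> Pi\<^sub>E {..<N * m} (targets n N).
      \<forall>e\<in>forest_of m N f - \<Union>(cycles (forest_digraph n N (forest_of m N f))). horizontal_edge e}"
    unfolding horizontal_forests_def by (simp only: Collect_mem_eq Compr_image_eq)
  also have "{f \<in> Pi\<^sub>E {..<N * m} (targets n N).
      \<forall>e\<in>forest_of m N f - \<Union>(cycles (forest_digraph n N (forest_of m N f))). horizontal_edge e} =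
    {f \<in> Pi\<^sub>E {..<N * m} (targets n N). ?G f - \<Union>(circuits (?G f)) \<subseteq> {(v, w). v mod N = w mod N}}"
    using iff[OF forest_of_in_forests[OF assms(2,3)]] by (intro Collect_cong conj_cong refl)
  finally show ?thesis .
qed

theorem theorem5p1:
  fixes n m N :: nat
    and \<tau> :: "'h::ring_1 \<Rightarrow> 'k::comm_ring_1"
    and h :: "nat \<Rightarrow> nat \<Rightarrow> 'h mat"
  assumes "2 \<le> n" and "1 \<le> m" and "m \<le> n" and "1 \<le> N"
    and "additive \<tau>"
    and "\<And>x y. \<tau> (x * y) = \<tau> (y * x)"
    and "\<tau> 1 = 1"
    and "\<And>i j. (i, j) \<in> edges n \<Longrightarrow> h i j \<in> carrier_mat N N"
  shows "det_tau \<tau> (leading_submatrix (N * m) (Delta n N h)) =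
    (\<Sum>F\<in>horizontal_forests n m N.
       (\<Prod>e\<in>F. edge_indet e) *
       (\<Prod>c\<in>horizontal_cycles n N F. 1 - Const (\<tau> (forest_holonomy n N h F c))) *
       (\<Prod>c\<in>skew_cycles n N F. - Const (\<tau> (forest_holonomy n N h F c))))"
proof -
  let ?U = "{..<N * m}" and ?Hz = "{(v, w). v mod N = w mod N}"
  let ?y = "\<lambda>c. Const (\<tau> (circuit_prod (\<lambda>(v, w). hat_h h (position N v, position N w)) c))"
  let ?x = "\<lambda>(v, w). indet (v div N) (w div N) :: 'k mpoly"
  let ?P = "map_prod (position N) (position N)"
  let ?C = "\<lambda>f. circuits (graph_of ?U f)"
  let ?HC = "\<lambda>f. {c \<in> ?C f. c \<subseteq> ?Hz}"
  let ?fun = "{f \<in> Pi\<^sub>E ?U (targets n N). graph_of ?U f - \<Union>(?C f) \<subseteq> ?Hz}"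
  have "det_tau \<tau> (leading_submatrix (N * m) (Delta n N h)) =
      (\<Sum>\<sigma> | \<sigma> permutes ?U. (\<Prod>c\<in>circuits (graph_of ?U \<sigma> - Id). - ?y c) *
        (\<Prod>v\<in>?U. \<Sum>w\<in>(if \<sigma> v = v then {w \<in> targets n N v. (v, w) \<in> ?Hz} else targets n N v \<inter> {\<sigma> v}). ?x (v, w)))"
  proof -
    have dim: "dim_row (leading_submatrix (N * m) (Delta n N h)) = N * m"
      by (simp add: leading_submatrix_def)
    show ?thesis
      unfolding det_tau_def dim
      by (rule sum.cong[OF refl], rule det_tau_term[OF assms(3,4,5,7,8)]) simp_all
  qed
  also have "\<dots> = (\<Sum>f\<in>?fun. (\<Prod>v\<in>?U. ?x (v, f v)) *
      ((\<Prod>c\<in>?HC f. 1 - ?y c) * (\<Prod>c\<in>?C f - ?HC f. - ?y c)))"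
    by (rule sum_permutations_eq_sum_functions) (auto simp: targets_def)
  also have "\<dots> = (\<Sum>f\<in>?fun. (\<Prod>e\<in>forest_of m N f. edge_indet e) *
       (\<Prod>c\<in>horizontal_cycles n N (forest_of m N f).
          1 - Const (\<tau> (forest_holonomy n N h (forest_of m N f) c))) *
       (\<Prod>c\<in>skew_cycles n N (forest_of m N f).
          - Const (\<tau> (forest_holonomy n N h (forest_of m N f) c))))"
  proof (rule sum.cong[OF refl])
    fix f assume "f \<in> ?fun"
    then have F: "forest_of m N f \<in> forests n m N"
      using forest_of_in_forests[OF assms(3,4)] by blast
    have inj: "inj_on ((`) ?P) A" for A
      using inj_image_eq_iff[OF inj_map_position] by (auto simp: inj_on_def)
    have horizontal: "(\<forall>e\<in>?P ` c. horizontal_edge e) \<longleftrightarrow> c \<subseteq> ?Hz" for c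
      by (simp add: horizontal_edge_position subset_eq del: map_prod_simp)
    have hc: "horizontal_cycles n N (forest_of m N f) = (`) ?P ` ?HC f"
      unfolding horizontal_cycles_def cycles_forest_of(1)[OF F] Compr_image_eq horizontal ..
    have sc: "skew_cycles n N (forest_of m N f) = (`) ?P ` (?C f - ?HC f)"
      unfolding skew_cycles_def hc cycles_forest_of(1)[OF F]
      by (rule inj_on_image_set_diff[OF inj, symmetric]) auto
    have y: "Const (\<tau> (forest_holonomy n N h (forest_of m N f) (?P ` c))) = ?y c" if "c \<in> ?C f" for c
      using cycles_forest_of(2)[OF F, of \<tau>, OF assms(6) that] by simp
    have "inj_on (\<lambda>v. (position N v, position N (f v))) ?U"
      by (simp add: inj_on_def inj_eq[OF inj_position])
    then have "(\<Prod>e\<in>forest_of m N f. edge_indet e) = (\<Prod>v\<in>?U. ?x (v, f v))"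
      unfolding forest_of_def graph_of_def image_image map_prod_simp
      by (subst prod.reindex) (auto simp: edge_indet_def position_def)
    moreover have "(\<Prod>c\<in>horizontal_cycles n N (forest_of m N f).
        1 - Const (\<tau> (forest_holonomy n N h (forest_of m N f) c))) = (\<Prod>c\<in>?HC f. 1 - ?y c)"
      unfolding hc prod.reindex[OF inj] by (rule prod.cong) (simp_all add: y)
    moreover have "(\<Prod>c\<in>skew_cycles n N (forest_of m N f).
        - Const (\<tau> (forest_holonomy n N h (forest_of m N f) c))) = (\<Prod>c\<in>?C f - ?HC f. - ?y c)"
      unfolding sc prod.reindex[OF inj] by (rule prod.cong) (simp_all add: y)
    ultimately show "(\<Prod>v\<in>?U. ?x (v, f v)) * ((\<Prod>c\<in>?HC f. 1 - ?y c) * (\<Prod>c\<in>?C f - ?HC f. - ?y c)) =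
       (\<Prod>e\<in>forest_of m N f. edge_indet e) *
       (\<Prod>c\<in>horizontal_cycles n N (forest_of m N f).
          1 - Const (\<tau> (forest_holonomy n N h (forest_of m N f) c))) *
       (\<Prod>c\<in>skew_cycles n N (forest_of m N f).
          - Const (\<tau> (forest_holonomy n N h (forest_of m N f) c)))"
      by (simp only: mult.assoc)
  qed
  also have "\<dots> = (\<Sum>F\<in>horizontal_forests n m N.
       (\<Prod>e\<in>F. edge_indet e) *
       (\<Prod>c\<in>horizontal_cycles n N F. 1 - Const (\<tau> (forest_holonomy n N h F c))) *
       (\<Prod>c\<in>skew_cycles n N F. - Const (\<tau> (forest_holonomy n N h F c))))"
  proof -
    have "inj_on (forest_of m N) ?fun"
      by (rule inj_on_subset[OF inj_on_forest_of[of m N "targets n N"]]) blast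
    then show ?thesis
      unfolding horizontal_forests_eq[OF assms(2-4)] by (subst sum.reindex) (simp_all add: comp_def)
  qed
  finally show ?thesis .
qed

end
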